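(* Let $H$ be a $p$-variate cumulative distribution function with continuous margins $F_1,\ldots,F_p$ and copula $C$, and suppose that for every $j\in\{1,\ldots,p\}$ the first-order partial derivative $\dot C_j(\mathbf u)=\partial C(\mathbf u)/\partial u_j$ exists and is continuous on the set $\{\mathbf u\in[0,1]^p: 0<u_j<1\}$. Let $\hat H_n$ be random $p$-variate cumulative distribution functions and $\hat F_{n,1},\ldots,\hat F_{n,p}$ random univariate cumulative distribution functions (estimators of $H$ and $F_1,\ldots,F_p$; $\hat F_{n,j}$ need not be the $j$th margin of $\hat H_n$), and define the hybrid copula estimator \[\hat C_n(\mathbf u)=\hat H_n\bigl(\hat F_{n,1}^\leftarrow(u_1),\ldots,\hat F_{n,p}^\leftarrow(u_p)\bigr),\qquad \mathbf u\in[0,1]^p.\] Assume there exists $0<r_n\to\infty$ such that, in the product space $\ell^\infty(\mathbb R^p)\times\ell^\infty(\mathbb R)\times\cdots\times\ell^\infty(\mathbb R)$ ($p$ copies of $\ell^\infty(\mathbb R)$) equipped with the topology of uniform convergence, we have joint weak convergence \[\bigl(r_n(\hat H_n-H);\,r_n(\hat F_{n,1}-F_1),\ldots,r_n(\hat F_{n,p}-F_p)\bigr)\rightsquigarrow(\alpha\circ\mathbf F;\,\beta_1\circ F_1,\ldots,\beta_p\circ F_p),\qquad n\to\infty,\] where $\alpha$ is a random element of $\ell^\infty([0,1]^p)$ and $\beta_j$ are random elements of $\ell^\infty([0,1])$ such that $\alpha\circ\mathbf F$ and $\beta_j\circ F_j$ have continuous trajectories on $[-\infty,\infty]^p$ and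 $[-\infty,\infty]$, respectively, almost surely. Then, uniformly in $\mathbf u\in[0,1]^p$, as $n\to\infty$, \[r_n\{\hat C_n(\mathbf u)-C(\mathbf u)\}=r_n\{\hat H_n(\mathbf F^\leftarrow(\mathbf u))-C(\mathbf u)\}-\sum_{j=1}^p\dot C_j(\mathbf u)\,r_n\{\hat F_{n,j}(F_j^\leftarrow(u_j))-u_j\}\,\mathbb 1_{(0,1)}(u_j)+o_p(1).\] Hence, in $\ell^\infty([0,1]^p)$ with the supremum norm, as $n\to\infty$, \[\bigl(r_n\{\hat C_n(\mathbf u)-C(\mathbf u)\}\bigr)_{\mathbf u\in[0,1]^p}\rightsquigarrow\Bigl(\alpha(\mathbf u)-\sum_{j=1}^p\dot C_j(\mathbf u)\,\beta_j(u_j)\Bigr)_{\mathbf u\in[0,1]^p}.\] Moreover, the processes $\alpha$ and $\beta_j$ have continuous trajectories almost surely, and $\beta_j(0)=\beta_j(1)=0$ almost surely (so the right-hand side of the limit is well-defined).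
   Context: For a univariate cumulative distribution function $G$, $G^\leftarrow(u)=\inf\{x\in\mathbb R: G(x)\ge u\}$ for $u\in[0,1]$, with conventions $\inf\varnothing=+\infty$, $G(-\infty)=0$, $G(+\infty)=1$. Write $\mathbf F(\mathbf x)=(F_1(x_1),\ldots,F_p(x_p))$ and $\mathbf F^\leftarrow(\mathbf u)=(F_1^\leftarrow(u_1),\ldots,F_p^\leftarrow(u_p))$. The copula $C$ satisfies $H(\mathbf x)=C(\mathbf F(\mathbf x))$ and $C(\mathbf u)=H(\mathbf F^\leftarrow(\mathbf u))$. $\ell^\infty(T)$ is the space of bounded real functions on $T$ with the supremum norm. $\rightsquigarrow$ denotes weak convergence in the sense of Hoffmann-Jørgensen, and $o_p(1)$ refers to remainder terms converging to zero in outer probability uniformly in $\mathbf u$. $\mathbb 1_{(0,1)}$ is the indicator of $(0,1)$. *)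

theory Defs
  imports "HOL-Probability.Probability"
begin

definition uni_cdf :: "(real \<Rightarrow> real) \<Rightarrow> bool" where
  "uni_cdf G \<longleftrightarrow> (\<exists>\<mu>. real_distribution \<mu> \<and> G = cdf \<mu>)"

definition uni_ext :: "(real \<Rightarrow> real) \<Rightarrow> ereal \<Rightarrow> real" where
  "uni_ext G x = (case x of ereal r \<Rightarrow> G r | PInfty \<Rightarrow> 1 | MInfty \<Rightarrow> 0)"

text \<open>Generalized inverse G^{<-}(u) = inf {x in R. G x >= u}, with inf of the empty set = +infinity.\<close>
definition gen_inv :: "(real \<Rightarrow> real) \<Rightarrow> real \<Rightarrow> ereal" where
  "gen_inv G u = Inf {ereal x | x. u \<le> G x}"

definition mv_cdf_of :: "(real^'p::finite) measure \<Rightarrow> (real^'p \<Rightarrow> real) \<Rightarrow> bool" where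
  "mv_cdf_of \<mu> H \<longleftrightarrow> prob_space \<mu> \<and> sets \<mu> = sets borel \<and>
     (\<forall>x. H x = measure \<mu> {y. \<forall>i. y$i \<le> x$i})"

definition mv_cdf :: "(real^'p::finite \<Rightarrow> real) \<Rightarrow> bool" where
  "mv_cdf H \<longleftrightarrow> (\<exists>\<mu>. mv_cdf_of \<mu> H)"

text \<open>Evaluation of a multivariate CDF at points of the extended space [-infinity,infinity]^p
  (a coordinate -infinity gives 0; a coordinate +infinity is unconstrained, i.e. marginalized).\<close>
definition cdf_ext :: "(real^'p::finite \<Rightarrow> real) \<Rightarrow> ereal^'p \<Rightarrow> real" where
  "cdf_ext H x = measure (SOME \<mu>. mv_cdf_of \<mu> H) {y. \<forall>i. ereal (y$i) \<le> x$i}"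

definition margin :: "(real^'p::finite \<Rightarrow> real) \<Rightarrow> 'p \<Rightarrow> real \<Rightarrow> real" where
  "margin H j t = cdf_ext H (\<chi> i. if i = j then ereal t else \<infinity>)"

text \<open>C(u) = H(F^{<-}(u)); applied to (H, F) gives the copula, applied to
  (hat H_n, hat F_n) the hybrid estimator hat C_n.\<close>
definition copula_of :: "(real^'p::finite \<Rightarrow> real) \<Rightarrow> ('p \<Rightarrow> real \<Rightarrow> real) \<Rightarrow> real^'p \<Rightarrow> real" where
  "copula_of H F u = cdf_ext H (\<chi> j. gen_inv (F j) (u$j))"

definition unit_cube :: "(real^'p::finite) set" where
  "unit_cube = {u. \<forall>j. 0 \<le> u$j \<and> u$j \<le> 1}"

text \<open>ell^infinity(S): functions bounded on S (only values on S matter).\<close>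
definition linf :: "'i set \<Rightarrow> ('i \<Rightarrow> real) set" where
  "linf S = {f. bdd_above ((\<lambda>t. \<bar>f t\<bar>) ` S)}"

definition linf_dist :: "'i set \<Rightarrow> ('i \<Rightarrow> real) \<Rightarrow> ('i \<Rightarrow> real) \<Rightarrow> real" where
  "linf_dist S f g = (SUP t\<in>S. \<bar>f t - g t\<bar>)"

definition linf_bcont :: "'i set \<Rightarrow> (('i \<Rightarrow> real) \<Rightarrow> real) \<Rightarrow> bool" where
  "linf_bcont S h \<longleftrightarrow>
     (\<exists>B. \<forall>f\<in>linf S. \<bar>h f\<bar> \<le> B) \<and>
     (\<forall>f\<in>linf S. \<forall>e>0. \<exists>d>0. \<forall>g\<in>linf S. linf_dist S f g < d \<longrightarrow> \<bar>h g - h f\<bar> < e)"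

text \<open>Borel measurability of a map into the metric space ell^infinity(S)
  (equivalently: h o Y measurable for all bounded continuous h), w.r.t. the completed space.\<close>
definition linf_measurable :: "'b measure \<Rightarrow> 'i set \<Rightarrow> ('b \<Rightarrow> 'i \<Rightarrow> real) \<Rightarrow> bool" where
  "linf_measurable N S Y \<longleftrightarrow>
     (\<forall>h. linf_bcont S h \<longrightarrow> (\<lambda>\<omega>. h (Y \<omega>)) \<in> borel_measurable (completion N))"

definition outer_exp :: "'a measure \<Rightarrow> ('a \<Rightarrow> real) \<Rightarrow> real" where
  "outer_exp M f = Inf {integral\<^sup>L M U | U. U \<in> borel_measurable M \<and> integrable M U \<and>
                                          (\<forall>\<omega>\<in>space M. f \<omega> \<le> U \<omega>)}"

definition outer_prob :: "'a measure \<Rightarrow> 'a set \<Rightarrow> real" where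
  "outer_prob M A = Inf {measure M B | B. B \<in> sets M \<and> A \<inter> space M \<subseteq> B}"

text \<open>Weak convergence in the sense of Hoffmann-Joergensen in ell^infinity(S):
  X n are arbitrary maps on probability spaces M n with values in ell^infinity(S);
  the limit Y is a (Borel measurable) random element of ell^infinity(S) on N.\<close>
definition hj_weak_conv ::
  "(nat \<Rightarrow> 'a measure) \<Rightarrow> (nat \<Rightarrow> 'a \<Rightarrow> 'i \<Rightarrow> real) \<Rightarrow> 'b measure \<Rightarrow> 'i set \<Rightarrow> ('b \<Rightarrow> 'i \<Rightarrow> real) \<Rightarrow> bool"
  where
  "hj_weak_conv M X N S Y \<longleftrightarrow>
     (\<forall>n. \<forall>\<omega>\<in>space (M n). X n \<omega> \<in> linf S) \<and>
     (AE \<omega> in N. Y \<omega> \<in> linf S) \<and> linf_measurable N S Y \<and>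
     (\<forall>h. linf_bcont S h \<longrightarrow>
        (\<lambda>n. outer_exp (M n) (\<lambda>\<omega>. h (X n \<omega>))) \<longlonglongrightarrow> integral\<^sup>L (completion N) (\<lambda>\<omega>. h (Y \<omega>)))"

end

theory Submission
  imports Defs
begin

text \<open>
  Write \<open>f\<close> for the joint estimation process. Because its limit has continuous trajectories, with high outer
  probability \<open>f\<close> is bounded and varies little between points at which \<open>F\<close> is close. On such an event the rest is
  deterministic: with \<open>y\<close> the estimated quantiles of \<open>u\<close> and \<open>v = F(y)\<close>, the small modulus of \<open>f\<close> forces
  \<open>r (v - u)\<close> to be close to minus the marginal processes at \<open>u\<close>, and a coordinatewise mean value argument
  expands \<open>r (C(v) - C(u))\<close>. Near the faces of the cube the partial derivatives need not extend continuously,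
  but there the marginal processes are small since they vanish at the ends of the real line.

  Instead of tightness or an almost sure representation, the probabilistic part uses bounded Lipschitz
  functionals of the distance to such a set of well-behaved functions.
\<close>

section \<open>Bounded functions with the supremum distance\<close>

text \<open>The limit is not a continuous image of an element of \<open>linf UNIV\<close>: quantiles
  of \<open>F\<close> may be infinite, while the data are indexed by real points. Hence a family of
  Lipschitz maps \<open>lin_approx m\<close> reads the process at finite quantiles only, and the
  index \<open>m\<close> is always fixed before \<open>n\<close> grows. Closeness of points is
  measured through \<open>F\<close>, not by Euclidean distance. Continuity on the extended space
  descends to \<open>\<alpha>\<close> on the compact cube, where it is uniform, so
  \<open>\<alpha>\<close> composed with \<open>F\<close> has a uniform modulus in the distance of
  \<open>F\<close>-values. Flat stretches of \<open>F\<close>, across which quantiles jump, are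
  invisible to this distance. That \<open>\<beta>\<close> vanishes at 0 and 1 is a conclusion. Each
  \<open>r n * (Fhat - F)\<close> tends to 0 at both ends of the line, and this property survives
  uniform limits. Without it the indicator in the expansion could not be dropped in the limit, since
  \<open>D j\<close> is unspecified on the faces \<open>u$j = 0\<close> and \<open>u$j = 1\<close>.
  Outer expectation is only subadditive, so comparisons are made by one-sided majorants in both
  directions.\<close>

lemma linfI: "(\<And>t. t \<in> S \<Longrightarrow> \<bar>f t\<bar> \<le> B) \<Longrightarrow> f \<in> linf S"
  by (auto simp: linf_def bdd_above_def)

lemma linf_bounded: "f \<in> linf S \<Longrightarrow> \<exists>B. \<forall>t\<in>S. \<bar>f t\<bar> \<le> B"
  by (auto simp: linf_def bdd_above_def)

lemma linf_diff:
  assumes "f \<in> linf S" "g \<in> linf S"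
  shows "(\<lambda>t. f t - g t) \<in> linf S"
proof -
  obtain B where B: "\<And>t. t \<in> S \<Longrightarrow> \<bar>f t\<bar> \<le> B" using linf_bounded[OF assms(1)] by blast
  obtain B' where B': "\<And>t. t \<in> S \<Longrightarrow> \<bar>g t\<bar> \<le> B'" using linf_bounded[OF assms(2)] by blast
  show ?thesis
  proof (rule linfI)
    fix t assume "t \<in> S"
    then show "\<bar>f t - g t\<bar> \<le> B + B'" using B[of t] B'[of t] by linarith
  qed
qed

lemma abs_diff_le_linf_dist:
  assumes "f \<in> linf S" "g \<in> linf S" "t \<in> S"
  shows "\<bar>f t - g t\<bar> \<le> linf_dist S f g"
  using linf_diff[OF assms(1,2)] assms(3)
  unfolding linf_dist_def linf_def by (auto intro: cSUP_upper)

lemma linf_dist_le: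
  assumes "S \<noteq> {}" "\<And>t. t \<in> S \<Longrightarrow> \<bar>f t - g t\<bar> \<le> c"
  shows "linf_dist S f g \<le> c"
  unfolding linf_dist_def using assms by (auto intro: cSUP_least)

lemma linf_dist_commute: "linf_dist S f g = linf_dist S g f"
  by (simp add: linf_dist_def abs_minus_commute)

lemma linf_dist_nonneg:
  assumes "S \<noteq> {}" "f \<in> linf S" "g \<in> linf S"
  shows "0 \<le> linf_dist S f g"
  using assms abs_diff_le_linf_dist[OF assms(2,3)] by (meson abs_ge_zero ex_in_conv order_trans)

lemma linf_dist_self: "S \<noteq> {} \<Longrightarrow> linf_dist S f f = 0"
  by (simp add: linf_dist_def)

lemma linf_dist_triangle:
  assumes "S \<noteq> {}" "f \<in> linf S" "g \<in> linf S" "k \<in> linf S"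
  shows "linf_dist S f k \<le> linf_dist S f g + linf_dist S g k"
proof (rule linf_dist_le[OF assms(1)])
  fix t assume "t \<in> S"
  then show "\<bar>f t - k t\<bar> \<le> linf_dist S f g + linf_dist S g k"
    using abs_diff_le_linf_dist[OF assms(2,3), of t] abs_diff_le_linf_dist[OF assms(3,4), of t]
    by linarith
qed

lemma linf_bcont_of_lipschitz:
  assumes ne: "S \<noteq> {}" and bd: "\<And>f. f \<in> linf S \<Longrightarrow> \<bar>h f\<bar> \<le> B"
    and lip: "\<And>f g. f \<in> linf S \<Longrightarrow> g \<in> linf S \<Longrightarrow> \<bar>h g - h f\<bar> \<le> L * linf_dist S f g"
  shows "linf_bcont S h"
  unfolding linf_bcont_def
proof (intro conjI ballI allI impI)
  show "\<exists>B. \<forall>f\<in>linf S. \<bar>h f\<bar> \<le> B" using bd by blast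
  fix f :: "'a \<Rightarrow> real" and e :: real assume f: "f \<in> linf S" and e: "0 < e"
  show "\<exists>d>0. \<forall>g\<in>linf S. linf_dist S f g < d \<longrightarrow> \<bar>h g - h f\<bar> < e"
  \<comment> \<open>The denominator \<open>\<bar>L\<bar> + 1\<close> is positive whatever the sign
    of \<open>L\<close>.\<close>
  proof (intro exI[of _ "e / (\<bar>L\<bar> + 1)"] conjI ballI impI)
    show "0 < e / (\<bar>L\<bar> + 1)" using e by (simp add: add_nonneg_pos)
    fix g assume g: "g \<in> linf S" and d: "linf_dist S f g < e / (\<bar>L\<bar> + 1)"
    have n: "0 \<le> linf_dist S f g" using linf_dist_nonneg[OF ne f g] .
    have "\<bar>h g - h f\<bar> \<le> L * linf_dist S f g" by (rule lip[OF f g])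
    also have "\<dots> \<le> (\<bar>L\<bar> + 1) * linf_dist S f g" by (intro mult_right_mono n) simp
    also have "\<dots> < e" using d by (simp add: pos_less_divide_eq mult.commute add_nonneg_pos)
    finally show "\<bar>h g - h f\<bar> < e" .
  qed
qed

text \<open>An infimum of reals is informative only over a set bounded below; the penalty is
  nonnegative, so the bound on \<open>h\<close> suffices. With \<open>h = 0\<close> and
  \<open>k = 1\<close> the infimum is the distance to \<open>A\<close>.\<close>

lemma infconv_bounds:
  assumes ne: "S \<noteq> {}" and A: "A \<subseteq> linf S" "A \<noteq> {}"
    and B: "\<And>g. g \<in> A \<Longrightarrow> \<bar>h g\<bar> \<le> B" and k: "0 \<le> k" and f: "f \<in> linf S"
  shows "bdd_below ((\<lambda>g. h g + k * linf_dist S f g) ` A)"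
    and "- B \<le> (INF g\<in>A. h g + k * linf_dist S f g)"
proof -
  have *: "- B \<le> h g + k * linf_dist S f g" if "g \<in> A" for g
  proof -
    have "0 \<le> k * linf_dist S f g"
      using that A by (intro mult_nonneg_nonneg k linf_dist_nonneg[OF ne f]) auto
    then show ?thesis using B[OF that] by linarith
  qed
  then show "bdd_below ((\<lambda>g. h g + k * linf_dist S f g) ` A)" by (auto simp: bdd_below_def)
  show "- B \<le> (INF g\<in>A. h g + k * linf_dist S f g)"
    using A(2) * by (intro cINF_greatest)
qed

text \<open>By the triangle inequality each function under the infimum is \<open>k\<close>-Lipschitz
  in the base point, and an infimum keeps the constant.\<close>

lemma infconv_lipschitz:
  assumes ne: "S \<noteq> {}" and A: "A \<subseteq> linf S" "A \<noteq> {}"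
    and B: "\<And>g. g \<in> A \<Longrightarrow> \<bar>h g\<bar> \<le> B" and k: "0 \<le> k"
    and f: "f \<in> linf S" and f': "f' \<in> linf S"
  shows "\<bar>(INF g\<in>A. h g + k * linf_dist S f' g) - (INF g\<in>A. h g + k * linf_dist S f g)\<bar>
    \<le> k * linf_dist S f f'"
proof -
  have *: "(INF g\<in>A. h g + k * linf_dist S a g) \<le> (INF g\<in>A. h g + k * linf_dist S b g) + k * linf_dist S a b"
    if a: "a \<in> linf S" and b: "b \<in> linf S" for a b
  proof -
    have "(INF g\<in>A. h g + k * linf_dist S a g) - k * linf_dist S a b \<le> (INF g\<in>A. h g + k * linf_dist S b g)"
    proof (rule cINF_greatest[OF A(2)])
      fix g assume g: "g \<in> A"
      have "(INF g\<in>A. h g + k * linf_dist S a g) \<le> h g + k * linf_dist S a g"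
        by (rule cINF_lower[OF infconv_bounds(1)[OF ne A B k a] g])
      also have "k * linf_dist S a g \<le> k * (linf_dist S a b + linf_dist S b g)"
        using A g by (intro mult_left_mono[OF _ k] linf_dist_triangle[OF ne a b]) auto
      finally show "(INF g\<in>A. h g + k * linf_dist S a g) - k * linf_dist S a b \<le> h g + k * linf_dist S b g"
        by (simp add: algebra_simps)
    qed
    then show ?thesis by simp
  qed
  show ?thesis using *[OF f f'] *[OF f' f] by (simp add: linf_dist_commute[of S f' f])
qed

text \<open>The minorants are the inf-convolutions of \<open>h\<close> with \<open>k * linf_dist\<close>.\<close>

lemma linf_lipschitz_minorants:
  assumes ne: "S \<noteq> {}" and h: "linf_bcont S h"
  shows "\<exists>B l. (\<forall>f\<in>linf S. \<bar>h f\<bar> \<le> B) \<and> (\<forall>k. \<forall>f\<in>linf S. \<bar>l k f\<bar> \<le> B) \<and>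
    (\<forall>k. \<forall>f\<in>linf S. \<forall>g\<in>linf S. \<bar>l k g - l k f\<bar> \<le> real k * linf_dist S f g) \<and>
    (\<forall>k. \<forall>f\<in>linf S. l k f \<le> h f) \<and> (\<forall>f\<in>linf S. (\<lambda>k. l k f) \<longlonglongrightarrow> h f)"
proof -
  obtain B where B: "\<And>f. f \<in> linf S \<Longrightarrow> \<bar>h f\<bar> \<le> B"
    using h unfolding linf_bcont_def by blast
  have cont: "\<And>f e. f \<in> linf S \<Longrightarrow> e > 0 \<Longrightarrow>
      \<exists>d>0. \<forall>g\<in>linf S. linf_dist S f g < d \<longrightarrow> \<bar>h g - h f\<bar> < e"
    using h unfolding linf_bcont_def by blast
  define l where "l k f = (INF g\<in>linf S. h g + real k * linf_dist S f g)" for k f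
  have ne': "linf S \<noteq> {}" using linfI[of S "\<lambda>_. 0" 0] by auto
  have bdd: "bdd_below ((\<lambda>g. h g + real k * linf_dist S f g) ` linf S)" if "f \<in> linf S" for k f
    by (rule infconv_bounds(1)[where B = B]) (use ne ne' B that in auto)
  have le: "l k f \<le> h f" if "f \<in> linf S" for k f
    using cINF_lower[OF bdd[OF that] that] linf_dist_self[OF ne] by (simp add: l_def)
  have ge: "- B \<le> l k f" if "f \<in> linf S" for k f
    unfolding l_def by (rule infconv_bounds(2)) (use ne ne' B that in auto)
  have bl: "\<bar>l k f\<bar> \<le> B" if "f \<in> linf S" for k f
    using le[OF that] ge[OF that] B[OF that] by (smt (verit))
  have lip: "\<bar>l k g - l k f\<bar> \<le> real k * linf_dist S f g" if "f \<in> linf S" "g \<in> linf S" for k f g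
    unfolding l_def
    by (rule infconv_lipschitz[where A = "linf S" and B = B]) (use ne ne' B that in auto)
  have lim: "(\<lambda>k. l k f) \<longlonglongrightarrow> h f" if f: "f \<in> linf S" for f
  proof (rule LIMSEQ_I)
    fix e :: real assume e: "0 < e"
    obtain d where d: "d > 0" "\<And>g. g \<in> linf S \<Longrightarrow> linf_dist S f g < d \<Longrightarrow> \<bar>h g - h f\<bar> < e / 2"
      using cont[OF f, of "e/2"] e by auto
    \<comment> \<open>The oscillation of \<open>h\<close> is at most \<open>2 * B\<close>. Once
      \<open>k * d\<close> exceeds it, the penalty at distance \<open>d\<close> or more outweighs
      any gain, so only points near \<open>f\<close> matter for the infimum.\<close>
    obtain k0 :: nat where k0: "2 * B / d < real k0" using reals_Archimedean2 by blast
    show "\<exists>no. \<forall>k\<ge>no. norm (l k f - h f) < e"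
    proof (intro exI[of _ k0] allI impI)
      fix k assume k: "k0 \<le> k"
      have "h f - e / 2 \<le> l k f"
        unfolding l_def
      proof (rule cINF_greatest[OF ne'])
        fix g assume g: "g \<in> linf S"
        show "h f - e / 2 \<le> h g + real k * linf_dist S f g"
        proof (cases "linf_dist S f g < d")
          case True
          have "0 \<le> real k * linf_dist S f g" using linf_dist_nonneg[OF ne f g] by simp
          then show ?thesis using d(2)[OF g True] by linarith
        next
          case False
          have "2 * B \<le> real k0 * d" using k0 d(1) by (simp add: pos_divide_less_eq)
          also have "\<dots> \<le> real k * linf_dist S f g"
            using False k d(1) by (intro mult_mono) auto
          finally show ?thesis using B[OF f] B[OF g] e by linarith
        qed
      qed
      then show "norm (l k f - h f) < e" using le[OF f, of k] e by (simp add: abs_if)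
    qed
  qed
  show ?thesis using B bl lip le lim by (intro exI[of _ B] exI[of _ l]) simp
qed

section \<open>Outer expectation and weak convergence\<close>

context prob_space
begin

lemma outer_exp_bounds:
  fixes f :: "'a \<Rightarrow> real"
  assumes "\<forall>\<omega>\<in>space M. \<bar>f \<omega>\<bar> \<le> B"
  shows "bdd_below {integral\<^sup>L M U | U. U \<in> borel_measurable M \<and> integrable M U \<and> (\<forall>\<omega>\<in>space M. f \<omega> \<le> U \<omega>)}"
    and "{integral\<^sup>L M U | U. U \<in> borel_measurable M \<and> integrable M U \<and> (\<forall>\<omega>\<in>space M. f \<omega> \<le> U \<omega>)} \<noteq> {}"
proof -
  have "- B \<le> integral\<^sup>L M U" if "integrable M U" "\<forall>\<omega>\<in>space M. f \<omega> \<le> U \<omega>" for U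
  proof -
    have "- B \<le> U \<omega>" if w: "\<omega> \<in> space M" for \<omega>
      using \<open>\<forall>\<omega>\<in>space M. f \<omega> \<le> U \<omega>\<close> assms w by fastforce
    then have "integral\<^sup>L M (\<lambda>_. - B) \<le> integral\<^sup>L M U"
      using that(1) by (intro integral_mono) auto
    then show ?thesis by (simp add: prob_space)
  qed
  then show "bdd_below {integral\<^sup>L M U | U. U \<in> borel_measurable M \<and> integrable M U \<and> (\<forall>\<omega>\<in>space M. f \<omega> \<le> U \<omega>)}"
    by (auto simp: bdd_below_def)
  have "f \<omega> \<le> B" if "\<omega> \<in> space M" for \<omega> using assms that by fastforce
  then show "{integral\<^sup>L M U | U. U \<in> borel_measurable M \<and> integrable M U \<and> (\<forall>\<omega>\<in>space M. f \<omega> \<le> U \<omega>)} \<noteq> {}"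
    by (auto intro!: exI[of _ "\<lambda>_. B"])
qed

lemma outer_exp_le_integral:
  assumes "\<forall>\<omega>\<in>space M. \<bar>f \<omega>\<bar> \<le> B"
    and "integrable M U" "\<And>\<omega>. \<omega> \<in> space M \<Longrightarrow> f \<omega> \<le> U \<omega>"
  shows "outer_exp M f \<le> integral\<^sup>L M U"
  unfolding outer_exp_def using assms
  by (intro cInf_lower outer_exp_bounds(1)[of f B]) auto

lemma outer_exp_approx:
  assumes "\<forall>\<omega>\<in>space M. \<bar>f \<omega>\<bar> \<le> B" "0 < e"
  shows "\<exists>U. integrable M U \<and> (\<forall>\<omega>\<in>space M. f \<omega> \<le> U \<omega>) \<and> integral\<^sup>L M U < outer_exp M f + e"
proof -
  let ?X = "{integral\<^sup>L M U | U. U \<in> borel_measurable M \<and> integrable M U \<and> (\<forall>\<omega>\<in>space M. f \<omega> \<le> U \<omega>)}"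
  have "Inf ?X < outer_exp M f + e" using assms(2) by (simp add: outer_exp_def)
  then have "\<exists>x\<in>?X. x < outer_exp M f + e"
    by (rule cInf_lessD[OF outer_exp_bounds(2)[of f B, OF assms(1)]])
  then show ?thesis by auto
qed

lemma outer_exp_mono:
  assumes f: "\<And>\<omega>. \<omega> \<in> space M \<Longrightarrow> \<bar>f \<omega>\<bar> \<le> B" and g: "\<And>\<omega>. \<omega> \<in> space M \<Longrightarrow> \<bar>g \<omega>\<bar> \<le> B'"
    and le: "\<And>\<omega>. \<omega> \<in> space M \<Longrightarrow> f \<omega> \<le> g \<omega>"
  shows "outer_exp M f \<le> outer_exp M g"
proof (rule field_le_epsilon)
  fix e :: real assume "0 < e"
  obtain U where U: "integrable M U" "\<And>\<omega>. \<omega> \<in> space M \<Longrightarrow> g \<omega> \<le> U \<omega>"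
    "integral\<^sup>L M U < outer_exp M g + e"
    using outer_exp_approx[of g B' e] g \<open>0 < e\<close> by auto
  have "outer_exp M f \<le> integral\<^sup>L M U"
    using f le U(2) by (intro outer_exp_le_integral[of f B] U(1)) (auto intro: order_trans)
  then show "outer_exp M f \<le> outer_exp M g + e" using U(3) by linarith
qed

text \<open>Sums of measurable majorants are majorants. This inequality, used in both directions,
  replaces linearity when two nonmeasurable maps are compared.\<close>

lemma outer_exp_add_le:
  assumes f: "\<And>\<omega>. \<omega> \<in> space M \<Longrightarrow> \<bar>f \<omega>\<bar> \<le> B" and g: "\<And>\<omega>. \<omega> \<in> space M \<Longrightarrow> \<bar>g \<omega>\<bar> \<le> B'"
    and k: "\<And>\<omega>. \<omega> \<in> space M \<Longrightarrow> \<bar>k \<omega>\<bar> \<le> B''"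
    and le: "\<And>\<omega>. \<omega> \<in> space M \<Longrightarrow> f \<omega> \<le> g \<omega> + k \<omega>"
  shows "outer_exp M f \<le> outer_exp M g + outer_exp M k"
proof (rule field_le_epsilon)
  fix e :: real assume "0 < e"
  then have e: "0 < e / 2" by simp
  obtain U where U: "integrable M U" "\<And>\<omega>. \<omega> \<in> space M \<Longrightarrow> g \<omega> \<le> U \<omega>"
    "integral\<^sup>L M U < outer_exp M g + e / 2"
    using outer_exp_approx[of g B' "e / 2"] g e by auto
  obtain V where V: "integrable M V" "\<And>\<omega>. \<omega> \<in> space M \<Longrightarrow> k \<omega> \<le> V \<omega>"
    "integral\<^sup>L M V < outer_exp M k + e / 2"
    using outer_exp_approx[of k B'' "e / 2"] k e by auto
  have "outer_exp M f \<le> integral\<^sup>L M (\<lambda>\<omega>. U \<omega> + V \<omega>)"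
  proof (rule outer_exp_le_integral)
    show "\<forall>\<omega>\<in>space M. \<bar>f \<omega>\<bar> \<le> B" using f by auto
    show "integrable M (\<lambda>\<omega>. U \<omega> + V \<omega>)" using U V by simp
    show "f \<omega> \<le> U \<omega> + V \<omega>" if "\<omega> \<in> space M" for \<omega>
      using le[OF that] U(2)[OF that] V(2)[OF that] by linarith
  qed
  then show "outer_exp M f \<le> outer_exp M g + outer_exp M k + e" using U V by simp
qed

lemma outer_prob_bounds:
  shows "bdd_below {measure M B | B. B \<in> sets M \<and> A \<inter> space M \<subseteq> B}"
    and "{measure M B | B. B \<in> sets M \<and> A \<inter> space M \<subseteq> B} \<noteq> {}"
  by (auto simp: bdd_below_def intro!: exI[of _ 0] exI[of _ "space M"])

lemma outer_prob_nonneg: "0 \<le> outer_prob M A"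
  unfolding outer_prob_def using outer_prob_bounds(2)[of A] by (intro cInf_greatest) auto

lemma outer_prob_mono:
  assumes "A \<inter> space M \<subseteq> A'"
  shows "outer_prob M A \<le> outer_prob M A'"
  unfolding outer_prob_def
proof (rule cInf_superset_mono[OF outer_prob_bounds(2) outer_prob_bounds(1)])
  show "{measure M B | B. B \<in> sets M \<and> A' \<inter> space M \<subseteq> B} \<subseteq> {measure M B | B. B \<in> sets M \<and> A \<inter> space M \<subseteq> B}"
    using assms by (intro Collect_mono) (metis Int_lower2 le_inf_iff order_trans)
qed

lemma outer_prob_le_outer_exp:
  assumes f: "\<And>\<omega>. \<omega> \<in> space M \<Longrightarrow> 0 \<le> f \<omega> \<and> f \<omega> \<le> B"
    and A: "\<And>\<omega>. \<omega> \<in> A \<inter> space M \<Longrightarrow> 1 \<le> f \<omega>"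
  shows "outer_prob M A \<le> outer_exp M f"
proof (rule field_le_epsilon)
  fix e :: real assume "0 < e"
  have "\<forall>\<omega>\<in>space M. \<bar>f \<omega>\<bar> \<le> B" using f by auto
  from outer_exp_approx[of f B, OF this \<open>0 < e\<close>]
  obtain U where U: "integrable M U" "\<And>\<omega>. \<omega> \<in> space M \<Longrightarrow> f \<omega> \<le> U \<omega>"
    "integral\<^sup>L M U < outer_exp M f + e" by auto
  have [measurable]: "U \<in> borel_measurable M" using U(1) by simp
  have U0: "0 \<le> U \<omega>" if "\<omega> \<in> space M" for \<omega> using f[OF that] U(2)[OF that] by linarith
  \<comment> \<open>Markov's inequality is applied to the measurable majorant \<open>U\<close>, and
    the event where \<open>U\<close> reaches 1 covers \<open>A\<close>.\<close>
  let ?B = "{\<omega> \<in> space M. 1 \<le> U \<omega>}"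
  have sub: "A \<inter> space M \<subseteq> ?B" using A U(2) by (auto intro: order_trans)
  have "outer_prob M A \<le> measure M ?B"
    unfolding outer_prob_def using sub by (intro cInf_lower outer_prob_bounds) auto
  also have "\<dots> \<le> integral\<^sup>L M U / 1"
    by (rule integral_Markov_inequality_measure[OF U(1) sets.top]) (auto intro!: AE_I2 U0)
  finally show "outer_prob M A \<le> outer_exp M f + e" using U(3) by simp
qed

text \<open>A nearly optimal measurable cover of \<open>A\<close> yields the majorant
  \<open>a + b * indicator B\<close>. This turns closeness in outer probability into closeness of
  outer expectations.\<close>

lemma outer_exp_le_outer_prob:
  assumes f: "\<And>\<omega>. \<omega> \<in> space M \<Longrightarrow> 0 \<le> f \<omega> \<and> f \<omega> \<le> b" and a: "0 \<le> a" and b: "0 \<le> b"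
    and A: "\<And>\<omega>. \<omega> \<in> space M - A \<Longrightarrow> f \<omega> \<le> a"
  shows "outer_exp M f \<le> a + b * outer_prob M A"
proof (rule field_le_epsilon)
  fix e :: real assume "0 < e"
  let ?X = "{measure M B | B. B \<in> sets M \<and> A \<inter> space M \<subseteq> B}"
  \<comment> \<open>Dividing by \<open>b + 1\<close> instead of \<open>b\<close> also covers
    \<open>b = 0\<close>.\<close>
  have "Inf ?X < outer_prob M A + e / (b + 1)" using \<open>0 < e\<close> b by (simp add: outer_prob_def)
  then have "\<exists>x\<in>?X. x < outer_prob M A + e / (b + 1)"
    by (rule cInf_lessD[OF outer_prob_bounds(2)])
  then obtain B where B: "B \<in> sets M" "A \<inter> space M \<subseteq> B" "measure M B < outer_prob M A + e / (b + 1)"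
    by auto
  have "outer_exp M f \<le> integral\<^sup>L M (\<lambda>\<omega>. a + b * indicator B \<omega>)"
  proof (rule outer_exp_le_integral)
    show "integrable M (\<lambda>\<omega>. a + b * indicator B \<omega>)"
      using B(1) by (intro Bochner_Integration.integrable_add integrable_mult_right) (auto simp: emeasure_eq_measure)
    show "\<forall>\<omega>\<in>space M. \<bar>f \<omega>\<bar> \<le> b" using f by auto
    show "f \<omega> \<le> a + b * indicator B \<omega>" if w: "\<omega> \<in> space M" for \<omega>
      using f[OF w] A[of \<omega>] w B(2) a b by (cases "\<omega> \<in> A") (auto simp: indicator_def)
  qed
  also have "\<dots> = a + b * measure M B" using B(1) by (simp add: prob_space emeasure_eq_measure)
  also have "\<dots> \<le> a + b * (outer_prob M A + e / (b + 1))"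
    using B(3) b by (intro add_left_mono mult_left_mono) auto
  also have "\<dots> = a + b * outer_prob M A + b / (b + 1) * e" by (simp add: algebra_simps)
  also have "\<dots> \<le> a + b * outer_prob M A + 1 * e"
    using b \<open>0 < e\<close> by (intro add_left_mono mult_right_mono) auto
  finally show "outer_exp M f \<le> a + b * outer_prob M A + e" by simp
qed

end

section \<open>Testing weak convergence with Lipschitz functionals\<close>

lemma borel_measurable_completion_cong_AE:
  fixes f g :: "'b \<Rightarrow> real"
  assumes f: "f \<in> borel_measurable (completion N)" and ae: "AE x in N. f x = g x"
  shows "g \<in> borel_measurable (completion N)"
proof (rule measurableI)
  fix A :: "real set" assume A: "A \<in> sets borel"
  show "g -` A \<inter> space (completion N) \<in> sets (completion N)"
  proof (rule completion.in_sets_AE)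
    show "f -` A \<inter> space (completion N) \<in> sets (completion N)" using f A by (rule measurable_sets)
    show "AE x in completion N. (x \<in> f -` A \<inter> space (completion N)) = (x \<in> g -` A \<inter> space (completion N))"
      using AE_completion[OF ae] by eventually_elim auto
  qed auto
qed auto

lemma linf_measurableD:
  "linf_measurable N S Y \<Longrightarrow> linf_bcont S h \<Longrightarrow> (\<lambda>\<omega>. h (Y \<omega>)) \<in> borel_measurable (completion N)"
  by (simp add: linf_measurable_def)

lemma hj_weak_convD:
  "hj_weak_conv M X N S Y \<Longrightarrow> linf_bcont S h \<Longrightarrow>
    (\<lambda>n. outer_exp (M n) (\<lambda>\<omega>. h (X n \<omega>))) \<longlonglongrightarrow> integral\<^sup>L (completion N) (\<lambda>\<omega>. h (Y \<omega>))"
  by (simp add: hj_weak_conv_def)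

lemma linf_measurable_integrable:
  assumes N: "prob_space N" and Y: "AE \<omega> in N. Y \<omega> \<in> linf S" and m: "linf_measurable N S Y"
    and h: "linf_bcont S h"
  shows "integrable (completion N) (\<lambda>\<omega>. h (Y \<omega>))"
proof -
  interpret prob_space "completion N" using N by (rule prob_space.prob_space_completion)
  obtain B where B: "\<And>f. f \<in> linf S \<Longrightarrow> \<bar>h f\<bar> \<le> B"
    using h unfolding linf_bcont_def by blast
  have "AE \<omega> in completion N. norm (h (Y \<omega>)) \<le> B"
    using AE_completion[OF Y] by eventually_elim (simp add: B)
  then show ?thesis
    using m h unfolding linf_measurable_def by (intro integrable_const_bound) auto
qed

text \<open>A Lipschitz Urysohn function, rising from 0 on \<open>A\<close> to 1 at distance
  \<open>e\<close>. It stands in for the indicator of being far from \<open>A\<close>, which is not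
  a continuous functional.\<close>

definition linf_bump :: "'i set \<Rightarrow> ('i \<Rightarrow> real) set \<Rightarrow> real \<Rightarrow> ('i \<Rightarrow> real) \<Rightarrow> real" where
  "linf_bump S A e f = min 1 ((INF g\<in>A. linf_dist S f g) / e)"

lemma linf_bump:
  assumes ne: "S \<noteq> {}" and A: "A \<subseteq> linf S" "A \<noteq> {}" and e: "0 < e"
  shows "linf_bcont S (linf_bump S A e)"
    and "\<And>f. f \<in> linf S \<Longrightarrow> 0 \<le> linf_bump S A e f"
    and "linf_bump S A e f \<le> 1"
    and "\<And>f. f \<in> A \<Longrightarrow> linf_bump S A e f = 0"
    and "\<And>f. f \<in> linf S \<Longrightarrow> (\<And>g. g \<in> A \<Longrightarrow> e \<le> linf_dist S f g) \<Longrightarrow> linf_bump S A e f = 1"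
proof -
  define d where "d f = (INF g\<in>A. linf_dist S f g)" for f
  have bump: "linf_bump S A e f = min 1 (d f / e)" for f by (simp add: linf_bump_def d_def)
  have d0: "0 \<le> d f" if "f \<in> linf S" for f
    using infconv_bounds(2)[OF ne A, of "\<lambda>_. 0" 0 1 f] that by (simp add: d_def)
  show ge0: "0 \<le> linf_bump S A e f" if "f \<in> linf S" for f
    using d0[OF that] e by (simp add: bump)
  show le1: "linf_bump S A e f \<le> 1" for f by (simp add: bump)
  have lip: "\<bar>d g - d f\<bar> \<le> linf_dist S f g" if "f \<in> linf S" "g \<in> linf S" for f g
    using infconv_lipschitz[OF ne A, of "\<lambda>_. 0" 0 1 f g] that by (simp add: d_def)
  show "linf_bcont S (linf_bump S A e)"
  proof (rule linf_bcont_of_lipschitz[OF ne, where B = 1 and L = "1 / e"])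
    show "\<bar>linf_bump S A e f\<bar> \<le> 1" if "f \<in> linf S" for f using ge0[OF that] le1[of f] by simp
    show "\<bar>linf_bump S A e g - linf_bump S A e f\<bar> \<le> 1 / e * linf_dist S f g"
      if "f \<in> linf S" "g \<in> linf S" for f g
    proof -
      have "\<bar>linf_bump S A e g - linf_bump S A e f\<bar> \<le> \<bar>d g / e - d f / e\<bar>"
        unfolding bump by linarith
      also have "\<dots> = \<bar>d g - d f\<bar> / e" using e by (simp add: diff_divide_distrib[symmetric])
      finally show ?thesis using lip[OF that] e by (simp add: divide_right_mono order_trans)
    qed
  qed
  show "linf_bump S A e f = 0" if f: "f \<in> A" for f
  proof -
    have "d f \<le> linf_dist S f f"
      unfolding d_def using infconv_bounds(1)[OF ne A, of "\<lambda>_. 0" 0 1 f] A f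
      by (intro cINF_lower) auto
    then show ?thesis using d0[of f] A f linf_dist_self[OF ne, of f] by (auto simp: bump)
  qed
  show "linf_bump S A e f = 1" if "f \<in> linf S" "\<And>g. g \<in> A \<Longrightarrow> e \<le> linf_dist S f g" for f
  proof -
    have "e \<le> d f" unfolding d_def using A that by (intro cINF_greatest) auto
    then show ?thesis using e by (simp add: bump)
  qed
qed

text \<open>The bump vanishes along every \<open>X n\<close>, so its expectation under the limit is
  0 and, being nonnegative, it vanishes almost surely at \<open>Y\<close>. This is how closed
  properties of the prelimit processes reach the limit.\<close>

lemma hj_weak_conv_limit_near:
  assumes N: "prob_space N" and M: "\<And>n. prob_space (M n)"
    and conv: "hj_weak_conv M X N S Y" and ne: "S \<noteq> {}"
    and A: "A \<subseteq> linf S" and X: "\<And>n \<omega>. \<omega> \<in> space (M n) \<Longrightarrow> X n \<omega> \<in> A" and e: "0 < e"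
  shows "AE \<omega> in N. \<exists>g\<in>A. linf_dist S (Y \<omega>) g < e"
proof -
  have A_ne: "A \<noteq> {}" using X prob_space.not_empty[OF M[of 0]] by blast
  note b = linf_bump[OF ne A A_ne e]
  have Y: "AE \<omega> in N. Y \<omega> \<in> linf S" and Ym: "linf_measurable N S Y"
    using conv unfolding hj_weak_conv_def by blast+
  have "outer_exp (M n) (\<lambda>\<omega>. linf_bump S A e (X n \<omega>)) = 0" for n
  proof -
    interpret prob_space "M n" by (rule M)
    have "outer_exp (M n) (\<lambda>\<omega>. linf_bump S A e (X n \<omega>)) \<le> integral\<^sup>L (M n) (\<lambda>_. 0)"
      by (rule outer_exp_le_integral[where B = 0]) (simp_all add: b(4) X)
    \<comment> \<open>Nonnegativity is read off from the Markov bound for the empty event.\<close>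
    moreover have "0 \<le> outer_exp (M n) (\<lambda>\<omega>. linf_bump S A e (X n \<omega>))"
      using order_trans[OF outer_prob_nonneg outer_prob_le_outer_exp[of "\<lambda>\<omega>. linf_bump S A e (X n \<omega>)" 0 "{}"]]
      by (simp add: b(4) X)
    ultimately show ?thesis by simp
  qed
  moreover have "(\<lambda>n. outer_exp (M n) (\<lambda>\<omega>. linf_bump S A e (X n \<omega>)))
      \<longlonglongrightarrow> integral\<^sup>L (completion N) (\<lambda>\<omega>. linf_bump S A e (Y \<omega>))"
    using conv b(1) by (simp add: hj_weak_conv_def)
  ultimately have 0: "integral\<^sup>L (completion N) (\<lambda>\<omega>. linf_bump S A e (Y \<omega>)) = 0"
    by (simp add: LIMSEQ_const_iff)
  have "AE \<omega> in completion N. linf_bump S A e (Y \<omega>) = 0"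
  proof (subst integral_nonneg_eq_0_iff_AE[symmetric])
    show "AE \<omega> in completion N. 0 \<le> linf_bump S A e (Y \<omega>)"
      using AE_completion[OF Y] by eventually_elim (rule b(2))
  qed (use 0 linf_measurable_integrable[OF N Y Ym b(1)] in auto)
  then have "AE \<omega> in N. linf_bump S A e (Y \<omega>) = 0" by (simp add: AE_completion_iff)
  with Y show ?thesis
  proof eventually_elim
    case (elim \<omega>)
    then show ?case using b(5)[of "Y \<omega>"] by (metis not_le zero_neq_one)
  qed
qed

text \<open>The substitute for tightness. Dominated convergence makes the expected bump of
  \<open>Y\<close> small for large \<open>m\<close>; for such a fixed \<open>m\<close>, weak
  convergence moves this to \<open>X n\<close>, and Markov's inequality gives the outer
  probability.\<close>

lemma hj_weak_conv_outer_prob_far: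
  assumes N: "prob_space N" and M: "\<And>n. prob_space (M n)"
    and conv: "hj_weak_conv M X N S Y" and ne: "S \<noteq> {}"
    and A: "\<And>m. A m \<subseteq> linf S" "\<And>m. A m \<noteq> {}"
    and Y_A: "AE \<omega> in N. eventually (\<lambda>m. Y \<omega> \<in> A m) sequentially" and e: "0 < e" and \<eta>: "0 < \<eta>"
  shows "eventually (\<lambda>m. eventually (\<lambda>n. outer_prob (M n)
      {\<omega> \<in> space (M n). \<forall>g\<in>A m. e \<le> linf_dist S (X n \<omega>) g} < \<eta>) sequentially) sequentially"
proof -
  note b = linf_bump[OF ne A e]
  have Y: "AE \<omega> in N. Y \<omega> \<in> linf S" and Ym: "linf_measurable N S Y"
    and X: "\<And>n \<omega>. \<omega> \<in> space (M n) \<Longrightarrow> X n \<omega> \<in> linf S"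
    using conv unfolding hj_weak_conv_def by blast+
  interpret N: prob_space "completion N" using N by (rule prob_space.prob_space_completion)
  have "(\<lambda>m. integral\<^sup>L (completion N) (\<lambda>\<omega>. linf_bump S (A m) e (Y \<omega>)))
      \<longlonglongrightarrow> integral\<^sup>L (completion N) (\<lambda>\<omega>. 0)"
  proof (rule integral_dominated_convergence[where w = "\<lambda>_. 1"])
    show "(\<lambda>\<omega>. linf_bump S (A m) e (Y \<omega>)) \<in> borel_measurable (completion N)" for m
      using Ym b(1) by (simp add: linf_measurable_def)
    show "AE \<omega> in completion N. (\<lambda>m. linf_bump S (A m) e (Y \<omega>)) \<longlonglongrightarrow> 0"
      using AE_completion[OF Y_A]
    proof eventually_elim
      case (elim \<omega>)
      then have "eventually (\<lambda>m. linf_bump S (A m) e (Y \<omega>) = 0) sequentially"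
        by eventually_elim (rule b(4))
      then show ?case by (rule tendsto_eventually)
    qed
    show "AE \<omega> in completion N. norm (linf_bump S (A m) e (Y \<omega>)) \<le> 1" for m
      using AE_completion[OF Y] by eventually_elim (simp add: b(2,3))
  qed auto
  then have "eventually (\<lambda>m. integral\<^sup>L (completion N) (\<lambda>\<omega>. linf_bump S (A m) e (Y \<omega>)) < \<eta>) sequentially"
    using \<eta> by (simp add: order_tendstoD(2))
  then show ?thesis
  proof eventually_elim
    case (elim m)
    have "(\<lambda>n. outer_exp (M n) (\<lambda>\<omega>. linf_bump S (A m) e (X n \<omega>)))
      \<longlonglongrightarrow> integral\<^sup>L (completion N) (\<lambda>\<omega>. linf_bump S (A m) e (Y \<omega>))"
      using conv b(1) by (simp add: hj_weak_conv_def)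
    from order_tendstoD(2)[OF this elim] show ?case
    proof eventually_elim
      case (elim n)
      interpret prob_space "M n" by (rule M)
      have "outer_prob (M n) {\<omega> \<in> space (M n). \<forall>g\<in>A m. e \<le> linf_dist S (X n \<omega>) g}
          \<le> outer_exp (M n) (\<lambda>\<omega>. linf_bump S (A m) e (X n \<omega>))"
        by (rule outer_prob_le_outer_exp[where B = 1]) (auto simp: b X)
      then show ?case using elim by linarith
    qed
  qed
qed

lemma linf_bcont_compose:
  assumes h: "linf_bcont S' h" and ne: "S \<noteq> {}"
    and T: "\<And>f. f \<in> linf S \<Longrightarrow> T f \<in> linf S'"
    and lip: "\<And>f g. f \<in> linf S \<Longrightarrow> g \<in> linf S \<Longrightarrow> linf_dist S' (T f) (T g) \<le> L * linf_dist S f g"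
  shows "linf_bcont S (\<lambda>f. h (T f))"
  unfolding linf_bcont_def
proof (intro conjI ballI allI impI)
  show "\<exists>B. \<forall>f\<in>linf S. \<bar>h (T f)\<bar> \<le> B" using h T unfolding linf_bcont_def by blast
  fix f e assume f: "f \<in> linf S" and "0 < (e::real)"
  then obtain d where d: "d > 0" "\<And>g. g \<in> linf S' \<Longrightarrow> linf_dist S' (T f) g < d \<Longrightarrow> \<bar>h g - h (T f)\<bar> < e"
    using h T[OF f] unfolding linf_bcont_def by meson
  show "\<exists>d>0. \<forall>g\<in>linf S. linf_dist S f g < d \<longrightarrow> \<bar>h (T g) - h (T f)\<bar> < e"
  proof (intro exI[of _ "d / (\<bar>L\<bar> + 1)"] conjI ballI impI)
    show "0 < d / (\<bar>L\<bar> + 1)" using d by (simp add: add_nonneg_pos)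
    fix g assume g: "g \<in> linf S" and fg: "linf_dist S f g < d / (\<bar>L\<bar> + 1)"
    have "linf_dist S' (T f) (T g) \<le> L * linf_dist S f g" by (rule lip[OF f g])
    also have "\<dots> \<le> (\<bar>L\<bar> + 1) * linf_dist S f g"
      by (intro mult_right_mono linf_dist_nonneg ne f g) simp
    also have "\<dots> < d" using fg by (simp add: pos_less_divide_eq mult.commute add_nonneg_pos)
    finally show "\<bar>h (T g) - h (T f)\<bar> < e" by (intro d T g)
  qed
qed

lemma linf_bcont_sequentially:
  assumes h: "linf_bcont S h" and f: "f \<in> linf S" and g: "\<And>m. g m \<in> linf S"
    and lim: "(\<lambda>m. linf_dist S (g m) f) \<longlonglongrightarrow> 0"
  shows "(\<lambda>m. h (g m)) \<longlonglongrightarrow> h f"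
proof (rule tendstoI)
  fix e :: real assume "0 < e"
  then obtain d where d: "d > 0" "\<And>g. g \<in> linf S \<Longrightarrow> linf_dist S f g < d \<Longrightarrow> \<bar>h g - h f\<bar> < e"
    using h f unfolding linf_bcont_def by meson
  show "eventually (\<lambda>m. dist (h (g m)) (h f) < e) sequentially"
    using order_tendstoD(2)[OF lim d(1)]
    by eventually_elim (auto simp: dist_real_def linf_dist_commute[of S f] intro!: d g)
qed

text \<open>\<open>Z\<close> need not be a continuous function of \<open>Y\<close> on the whole of \<open>linf S\<close>, only an almost sure limit
  of such functions.\<close>

theorem hj_weak_conv_approx:
  fixes X :: "nat \<Rightarrow> 'a \<Rightarrow> 'i \<Rightarrow> real" and X' :: "nat \<Rightarrow> 'a \<Rightarrow> 'j \<Rightarrow> real"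
  assumes N: "prob_space N" and M: "\<And>n. prob_space (M n)"
    and conv: "hj_weak_conv M X N S Y" and ne: "S \<noteq> {}" and ne': "S' \<noteq> {}"
    and X': "\<And>n \<omega>. \<omega> \<in> space (M n) \<Longrightarrow> X' n \<omega> \<in> linf S'"
    and Z: "AE \<omega> in N. Z \<omega> \<in> linf S'"
    and T: "\<And>m f. f \<in> linf S \<Longrightarrow> T m f \<in> linf S'"
    and lip: "\<And>m f g. f \<in> linf S \<Longrightarrow> g \<in> linf S \<Longrightarrow>
        linf_dist S' (T m f) (T m g) \<le> L m * linf_dist S f g"
    and TY: "AE \<omega> in N. (\<lambda>m. linf_dist S' (T m (Y \<omega>)) (Z \<omega>)) \<longlonglongrightarrow> 0"
    and close: "\<And>e \<eta>. 0 < e \<Longrightarrow> 0 < \<eta> \<Longrightarrow> eventually (\<lambda>m. eventually (\<lambda>n. outer_prob (M n)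
        {\<omega> \<in> space (M n). e < linf_dist S' (X' n \<omega>) (T m (X n \<omega>))} < \<eta>) sequentially) sequentially"
  shows "hj_weak_conv M X' N S' Z"
proof -
  have Y: "AE \<omega> in N. Y \<omega> \<in> linf S" and Ym: "linf_measurable N S Y"
    and X: "\<And>n \<omega>. \<omega> \<in> space (M n) \<Longrightarrow> X n \<omega> \<in> linf S"
    using conv unfolding hj_weak_conv_def by blast+
  interpret N: prob_space "completion N" using N by (rule prob_space.prob_space_completion)
  have bc: "linf_bcont S (\<lambda>f. h (T m f))" if "linf_bcont S' h" for h m
    by (rule linf_bcont_compose[OF that ne T lip])
  have hTY_meas: "(\<lambda>\<omega>. h (T m (Y \<omega>))) \<in> borel_measurable (completion N)" if "linf_bcont S' h" for h m
    by (rule linf_measurableD[OF Ym bc[OF that]])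
  have hTY_lim: "AE \<omega> in N. (\<lambda>m. h (T m (Y \<omega>))) \<longlonglongrightarrow> h (Z \<omega>)" if h: "linf_bcont S' h" for h
    using Y Z TY by eventually_elim (intro linf_bcont_sequentially[OF h] T)
  have Zm: "linf_measurable N S' Z"
    unfolding linf_measurable_def
  proof (intro allI impI)
    fix h assume h: "linf_bcont S' h"
    \<comment> \<open>\<open>lim\<close> is measurable everywhere, but equals
      \<open>h (Z \<omega>)\<close> only almost surely; completeness of the measure absorbs the
      exceptional null set.\<close>
    have "(\<lambda>\<omega>. lim (\<lambda>m. h (T m (Y \<omega>)))) \<in> borel_measurable (completion N)"
      using hTY_meas[OF h] by measurable
    then show "(\<lambda>\<omega>. h (Z \<omega>)) \<in> borel_measurable (completion N)"
      by (rule borel_measurable_completion_cong_AE)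
        (use hTY_lim[OF h] in \<open>eventually_elim, simp add: limI\<close>)
  qed
  \<comment> \<open>Lipschitz \<open>h\<close> come first: closeness of \<open>X'\<close> to
    \<open>T m X\<close> in outer probability controls \<open>h\<close> only through a modulus that
    is uniform over \<open>linf S'\<close>, which mere continuity does not provide.\<close>
  have lip_conv: "(\<lambda>n. outer_exp (M n) (\<lambda>\<omega>. h (X' n \<omega>))) \<longlonglongrightarrow> integral\<^sup>L (completion N) (\<lambda>\<omega>. h (Z \<omega>))"
    if hB: "\<And>f. f \<in> linf S' \<Longrightarrow> \<bar>h f\<bar> \<le> B"
      and hL: "\<And>f g. f \<in> linf S' \<Longrightarrow> g \<in> linf S' \<Longrightarrow> \<bar>h g - h f\<bar> \<le> K * linf_dist S' f g"
      and K: "0 \<le> K" for h B K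
  proof (rule LIMSEQ_I)
    fix e :: real assume e: "0 < e"
    have h: "linf_bcont S' h" using hB hL by (rule linf_bcont_of_lipschitz[OF ne'])
    have B: "0 \<le> B" using hB[of "\<lambda>_. 0"] linfI[of S' "\<lambda>_. 0" 0] by force
    have "(\<lambda>m. integral\<^sup>L (completion N) (\<lambda>\<omega>. h (T m (Y \<omega>)))) \<longlonglongrightarrow> integral\<^sup>L (completion N) (\<lambda>\<omega>. h (Z \<omega>))"
    proof (rule integral_dominated_convergence[where w = "\<lambda>_. B"])
      show "(\<lambda>\<omega>. h (Z \<omega>)) \<in> borel_measurable (completion N)"
        using Zm h by (simp add: linf_measurable_def)
      show "AE \<omega> in completion N. norm (h (T m (Y \<omega>))) \<le> B" for m
        using AE_completion[OF Y] by eventually_elim (simp add: hB T)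
    qed (use hTY_meas[OF h] AE_completion[OF hTY_lim[OF h]] in auto)
    then have ev1: "eventually (\<lambda>m. \<bar>integral\<^sup>L (completion N) (\<lambda>\<omega>. h (T m (Y \<omega>)))
        - integral\<^sup>L (completion N) (\<lambda>\<omega>. h (Z \<omega>))\<bar> < e / 4) sequentially"
      unfolding dist_real_def[symmetric] by (rule tendstoD) (use e in simp)
    \<comment> \<open>The budget \<open>e\<close> is split into e/4 for the limit in
      \<open>m\<close>, e/4 for the limit in \<open>n\<close>, and e/2 for the gap between
      \<open>X'\<close> and \<open>T m X\<close>: e/4 where they are \<open>d\<close>-close and e/4
      on the exceptional event. The added 1 allows \<open>K = 0\<close> or
      \<open>B = 0\<close>.\<close>
    define d where "d = e / (4 * (K + 1))"
    define \<eta> where "\<eta> = e / (8 * (B + 1))"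
    have d: "0 < d" and \<eta>: "0 < \<eta>" using e B K by (auto simp: d_def \<eta>_def)
    have small: "K * d + 2 * B * \<eta> \<le> e / 2"
    proof -
      have "K * d \<le> (K + 1) * d" "2 * B * \<eta> \<le> 2 * (B + 1) * \<eta>"
        using d \<eta> by (auto intro!: mult_right_mono)
      moreover have "(K + 1) * d = e / 4" "2 * (B + 1) * \<eta> = e / 4"
        using K B by (auto simp: d_def \<eta>_def field_simps)
      ultimately show ?thesis by linarith
    qed
    obtain m where m1: "\<bar>integral\<^sup>L (completion N) (\<lambda>\<omega>. h (T m (Y \<omega>)))
        - integral\<^sup>L (completion N) (\<lambda>\<omega>. h (Z \<omega>))\<bar> < e / 4"
      and m2: "eventually (\<lambda>n. outer_prob (M n)
        {\<omega> \<in> space (M n). d < linf_dist S' (X' n \<omega>) (T m (X n \<omega>))} < \<eta>) sequentially"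
      using eventually_happens[OF eventually_conj[OF ev1 close[OF d \<eta>]]] by auto
    have "(\<lambda>n. outer_exp (M n) (\<lambda>\<omega>. h (T m (X n \<omega>)))) \<longlonglongrightarrow> integral\<^sup>L (completion N) (\<lambda>\<omega>. h (T m (Y \<omega>)))"
      by (rule hj_weak_convD[OF conv bc[OF h]])
    then have "eventually (\<lambda>n. \<bar>outer_exp (M n) (\<lambda>\<omega>. h (T m (X n \<omega>)))
        - integral\<^sup>L (completion N) (\<lambda>\<omega>. h (T m (Y \<omega>)))\<bar> < e / 4) sequentially"
      unfolding dist_real_def[symmetric] by (rule tendstoD) (use e in simp)
    with m2 have "eventually (\<lambda>n. norm (outer_exp (M n) (\<lambda>\<omega>. h (X' n \<omega>))
        - integral\<^sup>L (completion N) (\<lambda>\<omega>. h (Z \<omega>))) < e) sequentially"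
    proof eventually_elim
      case (elim n)
      interpret prob_space "M n" by (rule M)
      define k where "k \<omega> = \<bar>h (X' n \<omega>) - h (T m (X n \<omega>))\<bar>" for \<omega>
      have b1: "\<bar>h (X' n \<omega>)\<bar> \<le> B" "\<bar>h (T m (X n \<omega>))\<bar> \<le> B" if "\<omega> \<in> space (M n)" for \<omega>
        using that by (auto intro!: hB X' T X)
      have k0: "0 \<le> k \<omega> \<and> k \<omega> \<le> 2 * B" if "\<omega> \<in> space (M n)" for \<omega>
        using b1[OF that] by (auto simp: k_def)
      have kB: "\<bar>k \<omega>\<bar> \<le> 2 * B" if "\<omega> \<in> space (M n)" for \<omega> using k0[OF that] by simp
      have "outer_exp (M n) k \<le> K * d + 2 * B * outer_prob (M n)
          {\<omega> \<in> space (M n). d < linf_dist S' (X' n \<omega>) (T m (X n \<omega>))}"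
      proof (rule outer_exp_le_outer_prob)
        fix \<omega> assume w: "\<omega> \<in> space (M n) - {\<omega> \<in> space (M n). d < linf_dist S' (X' n \<omega>) (T m (X n \<omega>))}"
        then have "k \<omega> \<le> K * linf_dist S' (X' n \<omega>) (T m (X n \<omega>))"
          using hL[of "X' n \<omega>" "T m (X n \<omega>)"] X' T X by (simp add: k_def abs_minus_commute)
        also have "\<dots> \<le> K * d" using w K by (intro mult_left_mono) auto
        finally show "k \<omega> \<le> K * d" .
      qed (use k0 K B d in auto)
      also have "\<dots> \<le> K * d + 2 * B * \<eta>"
        using elim(1) B by (intro add_left_mono mult_left_mono) auto
      also have "\<dots> \<le> e / 2" by (rule small)
      finally have k: "outer_exp (M n) k \<le> e / 2" .
      have "outer_exp (M n) (\<lambda>\<omega>. h (X' n \<omega>)) \<le> outer_exp (M n) (\<lambda>\<omega>. h (T m (X n \<omega>))) + outer_exp (M n) k"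
        by (rule outer_exp_add_le[OF b1(1) b1(2) kB]) (auto simp: k_def)
      moreover have "outer_exp (M n) (\<lambda>\<omega>. h (T m (X n \<omega>))) \<le> outer_exp (M n) (\<lambda>\<omega>. h (X' n \<omega>)) + outer_exp (M n) k"
        by (rule outer_exp_add_le[OF b1(2) b1(1) kB]) (auto simp: k_def)
      ultimately show ?case using k m1 elim(2) by (simp add: abs_if split: if_splits)
    qed
    then show "\<exists>no. \<forall>n\<ge>no. norm (outer_exp (M n) (\<lambda>\<omega>. h (X' n \<omega>))
        - integral\<^sup>L (completion N) (\<lambda>\<omega>. h (Z \<omega>))) < e"
      by (simp add: eventually_sequentially)
  qed
  have "(\<lambda>n. outer_exp (M n) (\<lambda>\<omega>. h (X' n \<omega>))) \<longlonglongrightarrow> integral\<^sup>L (completion N) (\<lambda>\<omega>. h (Z \<omega>))"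
    if h: "linf_bcont S' h" for h
  proof -
    \<comment> \<open>Negated minorants of \<open>- h\<close> are Lipschitz majorants of
      \<open>h\<close>. Squeezing \<open>h\<close> between a minorant and a majorant, each with its
      index fixed before \<open>n\<close> grows, reduces the claim to the Lipschitz case.\<close>
    have h': "linf_bcont S' (\<lambda>f. - h f)"
      using linf_bcont_def[THEN iffD1, OF h] by (simp add: linf_bcont_def abs_minus_commute)
    have int_lim: "(\<lambda>k. integral\<^sup>L (completion N) (\<lambda>\<omega>. l k (Z \<omega>))) \<longlonglongrightarrow> integral\<^sup>L (completion N) (\<lambda>\<omega>. g (Z \<omega>))"
      if "linf_bcont S' g" and l: "\<And>k f. f \<in> linf S' \<Longrightarrow> \<bar>l k f\<bar> \<le> B"
        "\<And>k f f'. f \<in> linf S' \<Longrightarrow> f' \<in> linf S' \<Longrightarrow> \<bar>l k f' - l k f\<bar> \<le> real k * linf_dist S' f f'"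
        "\<And>f. f \<in> linf S' \<Longrightarrow> (\<lambda>k. l k f) \<longlonglongrightarrow> g f" for g l B
    proof (rule integral_dominated_convergence[where w = "\<lambda>_. B"])
      show "(\<lambda>\<omega>. g (Z \<omega>)) \<in> borel_measurable (completion N)"
        using Zm that(1) by (simp add: linf_measurable_def)
      show "(\<lambda>\<omega>. l k (Z \<omega>)) \<in> borel_measurable (completion N)" for k
      proof -
        have "linf_bcont S' (l k)" by (rule linf_bcont_of_lipschitz[OF ne' l(1) l(2)])
        then show ?thesis using Zm by (simp add: linf_measurable_def)
      qed
      show "AE \<omega> in completion N. (\<lambda>k. l k (Z \<omega>)) \<longlonglongrightarrow> g (Z \<omega>)"
        using AE_completion[OF Z] by eventually_elim (rule l(3))
      show "AE \<omega> in completion N. norm (l k (Z \<omega>)) \<le> B" for k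
        using AE_completion[OF Z] by eventually_elim (simp add: l(1))
    qed auto
    obtain B l where "(\<forall>f\<in>linf S'. \<bar>h f\<bar> \<le> B) \<and> (\<forall>k. \<forall>f\<in>linf S'. \<bar>l k f\<bar> \<le> B) \<and>
      (\<forall>k. \<forall>f\<in>linf S'. \<forall>g\<in>linf S'. \<bar>l k g - l k f\<bar> \<le> real k * linf_dist S' f g) \<and>
      (\<forall>k. \<forall>f\<in>linf S'. l k f \<le> h f) \<and> (\<forall>f\<in>linf S'. (\<lambda>k. l k f) \<longlonglongrightarrow> h f)"
      using linf_lipschitz_minorants[OF ne' h] by blast
    then have l:
      "\<And>f. f \<in> linf S' \<Longrightarrow> \<bar>h f\<bar> \<le> B" "\<And>k f. f \<in> linf S' \<Longrightarrow> \<bar>l k f\<bar> \<le> B"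
      "\<And>k f g. f \<in> linf S' \<Longrightarrow> g \<in> linf S' \<Longrightarrow> \<bar>l k g - l k f\<bar> \<le> real k * linf_dist S' f g"
      "\<And>k f. f \<in> linf S' \<Longrightarrow> l k f \<le> h f"
      "\<And>f. f \<in> linf S' \<Longrightarrow> (\<lambda>k. l k f) \<longlonglongrightarrow> h f"
      by blast+
    obtain B' l' where "(\<forall>f\<in>linf S'. \<bar>- h f\<bar> \<le> B') \<and> (\<forall>k. \<forall>f\<in>linf S'. \<bar>l' k f\<bar> \<le> B') \<and>
      (\<forall>k. \<forall>f\<in>linf S'. \<forall>g\<in>linf S'. \<bar>l' k g - l' k f\<bar> \<le> real k * linf_dist S' f g) \<and>
      (\<forall>k. \<forall>f\<in>linf S'. l' k f \<le> - h f) \<and> (\<forall>f\<in>linf S'. (\<lambda>k. l' k f) \<longlonglongrightarrow> - h f)"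
      using linf_lipschitz_minorants[OF ne' h'] by blast
    then have l'0:
      "\<And>f. f \<in> linf S' \<Longrightarrow> \<bar>- h f\<bar> \<le> B'" "\<And>k f. f \<in> linf S' \<Longrightarrow> \<bar>l' k f\<bar> \<le> B'"
      "\<And>k f g. f \<in> linf S' \<Longrightarrow> g \<in> linf S' \<Longrightarrow> \<bar>l' k g - l' k f\<bar> \<le> real k * linf_dist S' f g"
      "\<And>k f. f \<in> linf S' \<Longrightarrow> l' k f \<le> - h f"
      "\<And>f. f \<in> linf S' \<Longrightarrow> (\<lambda>k. l' k f) \<longlonglongrightarrow> - h f"
      by blast+
    define u where "u k f = - l' k f" for k f
    have u: "\<bar>u k f\<bar> \<le> B'" "h f \<le> u k f" if "f \<in> linf S'" for k f
      using l'0(2)[OF that, of k] l'0(4)[OF that, of k] by (auto simp: u_def)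
    have ulip: "\<bar>u k g - u k f\<bar> \<le> real k * linf_dist S' f g" if "f \<in> linf S'" "g \<in> linf S'" for k f g
      using l'0(3)[OF that, of k] by (simp add: u_def abs_minus_commute)
    have ulim: "\<And>f. f \<in> linf S' \<Longrightarrow> (\<lambda>k. u k f) \<longlonglongrightarrow> h f"
      unfolding u_def by (drule l'0(5), drule tendsto_minus) simp
    let ?I = "integral\<^sup>L (completion N) (\<lambda>\<omega>. h (Z \<omega>))"
    show ?thesis
    proof (rule order_tendstoI)
      fix a assume "a < ?I"
      have "(\<lambda>k. integral\<^sup>L (completion N) (\<lambda>\<omega>. l k (Z \<omega>))) \<longlonglongrightarrow> ?I"
        by (rule int_lim[OF h l(2,3,5)])
      from order_tendstoD(1)[OF this \<open>a < ?I\<close>]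
      obtain k where k: "a < integral\<^sup>L (completion N) (\<lambda>\<omega>. l k (Z \<omega>))"
        using eventually_happens'[OF sequentially_bot] by blast
      have "(\<lambda>n. outer_exp (M n) (\<lambda>\<omega>. l k (X' n \<omega>))) \<longlonglongrightarrow> integral\<^sup>L (completion N) (\<lambda>\<omega>. l k (Z \<omega>))"
        by (rule lip_conv[OF l(2) l(3)]) auto
      from order_tendstoD(1)[OF this k]
      show "eventually (\<lambda>n. a < outer_exp (M n) (\<lambda>\<omega>. h (X' n \<omega>))) sequentially"
      proof eventually_elim
        case (elim n)
        interpret prob_space "M n" by (rule M)
        have "outer_exp (M n) (\<lambda>\<omega>. l k (X' n \<omega>)) \<le> outer_exp (M n) (\<lambda>\<omega>. h (X' n \<omega>))"
          by (rule outer_exp_mono[of _ B _ B]) (auto intro!: l X')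
        then show ?case using elim by linarith
      qed
    next
      fix a assume "?I < a"
      have "(\<lambda>k. integral\<^sup>L (completion N) (\<lambda>\<omega>. u k (Z \<omega>))) \<longlonglongrightarrow> ?I"
        by (rule int_lim[OF h u(1) ulip ulim])
      from order_tendstoD(2)[OF this \<open>?I < a\<close>]
      obtain k where k: "integral\<^sup>L (completion N) (\<lambda>\<omega>. u k (Z \<omega>)) < a"
        using eventually_happens'[OF sequentially_bot] by blast
      have "(\<lambda>n. outer_exp (M n) (\<lambda>\<omega>. u k (X' n \<omega>))) \<longlonglongrightarrow> integral\<^sup>L (completion N) (\<lambda>\<omega>. u k (Z \<omega>))"
        by (rule lip_conv[OF u(1) ulip]) auto
      from order_tendstoD(2)[OF this k]
      show "eventually (\<lambda>n. outer_exp (M n) (\<lambda>\<omega>. h (X' n \<omega>)) < a) sequentially"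
      proof eventually_elim
        case (elim n)
        interpret prob_space "M n" by (rule M)
        have "outer_exp (M n) (\<lambda>\<omega>. h (X' n \<omega>)) \<le> outer_exp (M n) (\<lambda>\<omega>. u k (X' n \<omega>))"
          by (rule outer_exp_mono[of _ B _ B']) (auto intro!: l u X')
        then show ?case using elim by linarith
      qed
    qed
  qed
  then show ?thesis unfolding hj_weak_conv_def using X' Z Zm by blast
qed

section \<open>Distribution functions and quantiles\<close>

text \<open>Tychonoff's theorem for functions into \<open>ereal\<close>, carried over by the
  continuous map \<open>vec_lambda\<close>.\<close>

lemma compact_UNIV_ereal_vec: "compact (UNIV :: (ereal^'p::finite) set)"
proof -
  have "compactin (product_topology (\<lambda>_. euclidean) UNIV) (PiE (UNIV::'p set) (\<lambda>_. UNIV :: ereal set))"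
    unfolding compactin_PiE by (simp add: compact_UNIV)
  then have "compact (UNIV :: ('p \<Rightarrow> ereal) set)"
    by (simp add: euclidean_product_topology)
  moreover have "continuous_on UNIV (\<lambda>f :: 'p \<Rightarrow> ereal. \<chi> i. f i)"
    by (intro continuous_on_vec_lambda continuous_on_product_coordinates)
  ultimately have "compact (range (\<lambda>f :: 'p \<Rightarrow> ereal. \<chi> i. f i))"
    by (rule compact_continuous_image[rotated])
  moreover have "range (\<lambda>f :: 'p \<Rightarrow> ereal. \<chi> i. f i) = UNIV"
    by (metis surjI vec_lambda_eta)
  ultimately show ?thesis by simp
qed

text \<open>A continuous map from a compact space to a Hausdorff space is closed, hence a quotient
  map onto its image. This removes \<open>F\<close> from a composition although \<open>F\<close> may
  have no continuous inverse.\<close>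

lemma continuous_on_compact_quotient:
  fixes f :: "'a::topological_space \<Rightarrow> 'b::t2_space" and g :: "'b \<Rightarrow> 'c::topological_space"
  assumes K: "compact K" and f: "continuous_on K f" and gf: "continuous_on K (\<lambda>x. g (f x))"
  shows "continuous_on (f ` K) g"
  unfolding continuous_on_closed_invariant
proof (intro allI impI)
  fix B :: "'c set" assume "closed B"
  then obtain A where A: "closed A" "A \<inter> K = (\<lambda>x. g (f x)) -` B \<inter> K"
    using gf unfolding continuous_on_closed_invariant by blast
  have "compact (f ` (A \<inter> K))"
    using A K f by (intro compact_continuous_image closed_Int_compact) (auto intro: continuous_on_subset)
  moreover have "f ` (A \<inter> K) \<inter> f ` K = g -` B \<inter> f ` K" using A(2) by auto
  ultimately show "\<exists>A. closed A \<and> A \<inter> f ` K = g -` B \<inter> f ` K"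
    using compact_imp_closed by blast
qed

lemma uni_cdf_mono: "uni_cdf G \<Longrightarrow> s \<le> t \<Longrightarrow> G s \<le> G t"
  unfolding uni_cdf_def
  by (metis finite_borel_measure.cdf_nondecreasing real_distribution.finite_borel_measure_M)

lemma uni_cdf_bounds: "uni_cdf G \<Longrightarrow> 0 \<le> G t" "uni_cdf G \<Longrightarrow> G t \<le> 1"
  unfolding uni_cdf_def
  by (metis finite_borel_measure.cdf_nonneg real_distribution.finite_borel_measure_M)
    (metis real_distribution.cdf_bounded_prob)

lemma uni_cdf_at_top: "uni_cdf G \<Longrightarrow> (G \<longlongrightarrow> 1) at_top"
  unfolding uni_cdf_def by (metis real_distribution.cdf_lim_at_top_prob)

lemma uni_cdf_at_bot: "uni_cdf G \<Longrightarrow> (G \<longlongrightarrow> 0) at_bot"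
  unfolding uni_cdf_def
  by (metis finite_borel_measure.cdf_lim_at_bot real_distribution.finite_borel_measure_M)

lemma uni_cdf_at_right: "uni_cdf G \<Longrightarrow> (G \<longlongrightarrow> G a) (at_right a)"
  unfolding uni_cdf_def
  by (metis continuous_within finite_borel_measure.cdf_is_right_cont real_distribution.finite_borel_measure_M)

lemma uni_ext_simps [simp]:
  "uni_ext G (ereal t) = G t" "uni_ext G \<infinity> = 1" "uni_ext G (-\<infinity>) = 0"
  by (simp_all add: uni_ext_def)

lemma uni_ext_bounds:
  assumes "uni_cdf G"
  shows "0 \<le> uni_ext G t" "uni_ext G t \<le> 1"
  using uni_cdf_bounds[OF assms] by (cases t; simp)+

text \<open>Clamping to \<open>[-k, k]\<close> gives real points approaching an extended point,
  along which inequalities known at real arguments pass to infinite ones.\<close>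

definition ereal_trunc :: "nat \<Rightarrow> ereal \<Rightarrow> real" where
  "ereal_trunc k x = real_of_ereal (max (- ereal (real k)) (min (ereal (real k)) x))"

lemma ereal_trunc_simps [simp]:
  "ereal_trunc k (ereal t) = max (- real k) (min (real k) t)"
  "ereal_trunc k \<infinity> = real k" "ereal_trunc k (-\<infinity>) = - real k"
  by (simp_all add: ereal_trunc_def max_def min_def)

lemma eventually_ereal_trunc_ereal: "eventually (\<lambda>k. ereal_trunc k (ereal t) = t) sequentially"
proof -
  obtain k0 :: nat where "\<bar>t\<bar> \<le> real k0" using real_arch_simple by blast
  then show ?thesis
    by (intro eventually_sequentiallyI[of k0]) (auto simp: max_def min_def)
qed

lemma eventually_le_ereal_trunc:
  "eventually (\<lambda>k. y \<le> ereal_trunc k x \<longleftrightarrow> ereal y \<le> x) sequentially"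
proof (cases x)
  case (real t)
  show ?thesis
    unfolding real using eventually_ereal_trunc_ereal[of t] by eventually_elim (simp del: ereal_trunc_simps)
next
  case PInf
  have "eventually (\<lambda>k. y \<le> real k) sequentially"
    using filterlim_real_sequentially by (simp add: filterlim_at_top)
  then show ?thesis by (simp add: PInf)
next
  case MInf
  \<comment> \<open>The extra 1 makes \<open>- real k\<close> strictly smaller than
    \<open>y\<close>, as the comparison with minus infinity must be false.\<close>
  have "eventually (\<lambda>k. - y + 1 \<le> real k) sequentially"
    using filterlim_real_sequentially by (simp add: filterlim_at_top)
  then show ?thesis by eventually_elim (simp add: MInf)
qed

lemma uni_ext_trunc_tendsto:
  assumes "uni_cdf G"
  shows "(\<lambda>k. G (ereal_trunc k x)) \<longlonglongrightarrow> uni_ext G x"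
proof (cases x)
  case (real t)
  show ?thesis
    unfolding real uni_ext_simps
    by (rule tendsto_eventually, rule eventually_mono[OF eventually_ereal_trunc_ereal[of t]]) simp
next
  case PInf
  then show ?thesis
    using filterlim_compose[OF uni_cdf_at_top[OF assms] filterlim_real_sequentially] by simp
next
  case MInf
  have "filterlim (\<lambda>k. - real k) at_bot sequentially"
    using filterlim_real_sequentially by (simp add: filterlim_uminus_at_top)
  from filterlim_compose[OF uni_cdf_at_bot[OF assms] this] MInf show ?thesis by simp
qed

lemma mv_cdf_some:
  assumes "mv_cdf H"
  defines "\<mu> \<equiv> SOME \<mu>. mv_cdf_of \<mu> H"
  shows "prob_space \<mu>" "sets \<mu> = sets borel" "\<And>x. H x = measure \<mu> {y. \<forall>i. y$i \<le> x$i}"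
    "\<And>x. cdf_ext H x = measure \<mu> {y. \<forall>i. ereal (y$i) \<le> x$i}"
proof -
  have "mv_cdf_of \<mu> H" unfolding \<mu>_def using assms(1) unfolding mv_cdf_def by (rule someI_ex)
  then show "prob_space \<mu>" "sets \<mu> = sets borel" "\<And>x. H x = measure \<mu> {y. \<forall>i. y$i \<le> x$i}"
    by (auto simp: mv_cdf_of_def)
  show "\<And>x. cdf_ext H x = measure \<mu> {y. \<forall>i. ereal (y$i) \<le> x$i}"
    by (simp add: cdf_ext_def \<mu>_def)
qed

lemma borel_ereal_halfspace: "{y :: real^'p::finite. ereal (y$i) \<le> t} \<in> sets borel"
proof -
  have "(\<lambda>y :: real^'p. ereal (y$i)) \<in> borel_measurable borel" by simp
  from measurable_sets[OF this, of "{..t}"] show ?thesis by (simp add: vimage_def)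
qed

lemma borel_ereal_orthant: "{y :: real^'p::finite. \<forall>i. ereal (y$i) \<le> x$i} \<in> sets borel"
proof -
  have "{y :: real^'p. \<forall>i. ereal (y$i) \<le> x$i} = (\<Inter>i. {y. ereal (y$i) \<le> x$i})" by auto
  then show ?thesis using borel_ereal_halfspace by auto
qed

lemma cdf_ext_bounds:
  assumes "mv_cdf H"
  shows "0 \<le> cdf_ext H x" "cdf_ext H x \<le> 1"
  using mv_cdf_some[OF assms] by (auto simp: prob_space.prob_le_1)

text \<open>The indicators of the truncated orthants converge pointwise, so dominated convergence
  applies. Consequently \<open>cdf_ext H\<close> is determined by \<open>H\<close> and does not
  depend on the measure picked by \<open>SOME\<close>.\<close>

lemma cdf_ext_trunc_tendsto:
  assumes "mv_cdf H"
  shows "(\<lambda>k. H (\<chi> i. ereal_trunc k (x$i))) \<longlonglongrightarrow> cdf_ext H x"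
proof -
  define \<mu> where "\<mu> = (SOME \<mu>. mv_cdf_of \<mu> H)"
  note mu = mv_cdf_some[OF assms, folded \<mu>_def]
  interpret prob_space \<mu> by (rule mu)
  have sp: "space \<mu> = UNIV" using sets_eq_imp_space_eq[OF mu(2)] by simp
  let ?A = "\<lambda>k. {y :: real^'a. \<forall>i. y$i \<le> ereal_trunc k (x$i)}" and ?B = "{y. \<forall>i. ereal (y$i) \<le> x$i}"
  have A: "?A k \<in> sets \<mu>" for k
    using borel_ereal_orthant[of "\<chi> i. ereal (ereal_trunc k (x$i))"] mu(2) by simp
  have B: "?B \<in> sets \<mu>" using borel_ereal_orthant mu(2) by simp
  have "(\<lambda>k. integral\<^sup>L \<mu> (indicator (?A k) :: _ \<Rightarrow> real)) \<longlonglongrightarrow> integral\<^sup>L \<mu> (indicator ?B)"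
  proof (rule integral_dominated_convergence[where w = "\<lambda>_. 1"])
    show "AE y in \<mu>. (\<lambda>k. indicator (?A k) y :: real) \<longlonglongrightarrow> indicator ?B y"
    proof (rule AE_I2, rule tendsto_eventually)
      fix y
      have "eventually (\<lambda>k. \<forall>i. y$i \<le> ereal_trunc k (x$i) \<longleftrightarrow> ereal (y$i) \<le> x$i) sequentially"
        by (intro eventually_all_finite eventually_le_ereal_trunc)
      then show "eventually (\<lambda>k. indicator (?A k) y = (indicator ?B y :: real)) sequentially"
        by eventually_elim (simp add: indicator_def)
    qed
  qed (use A B in \<open>auto simp: indicator_def\<close>)
  then show ?thesis using A B by (simp add: mu(3,4) sp)
qed

section \<open>Generalized inverses and the modulus of the marginal processes\<close>

lemma gen_inv_le: "u \<le> G x \<Longrightarrow> gen_inv G u \<le> ereal x"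
  unfolding gen_inv_def by (rule Inf_lower) auto

lemma less_gen_inv: "ereal s < gen_inv G u \<Longrightarrow> G s < u"
  using gen_inv_le[of u G s] by (meson not_le)

lemma gen_inv_less:
  assumes "uni_cdf G" "gen_inv G u < ereal x"
  shows "u \<le> G x"
proof -
  obtain x' where "u \<le> G x'" "x' < x" using assms(2) unfolding gen_inv_def Inf_less_iff by auto
  then show ?thesis using uni_cdf_mono[OF assms(1), of x' x] by linarith
qed

text \<open>Right-continuity makes a finite infimum a minimum.\<close>

lemma gen_inv_attained:
  assumes "uni_cdf G" "gen_inv G u = ereal y"
  shows "u \<le> G y"
proof (rule tendsto_lowerbound[OF uni_cdf_at_right[OF assms(1)]])
  show "eventually (\<lambda>x. u \<le> G x) (at_right y)"
    using gen_inv_less[OF assms(1)] assms(2) eventually_at_right_less[of y]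
    by (auto elim!: eventually_mono)
qed simp

text \<open>Together with the next lemma: for levels in the unit interval an infinite quantile
  occurs only at level 0 or 1, exactly where \<open>uni_ext\<close> has that value.\<close>

lemma gen_inv_MInf:
  assumes "uni_cdf G" "gen_inv G u = -\<infinity>"
  shows "u \<le> 0"
  by (rule tendsto_lowerbound[OF uni_cdf_at_bot[OF assms(1)]])
    (use gen_inv_less[OF assms(1)] assms(2) in auto)

lemma gen_inv_PInf:
  assumes "uni_cdf G" "gen_inv G u = \<infinity>"
  shows "1 \<le> u"
proof (rule tendsto_upperbound[OF uni_cdf_at_top[OF assms(1)]])
  have "G x \<le> u" for x using less_gen_inv[of x G u] assms(2) by simp
  then show "eventually (\<lambda>x. G x \<le> u) at_top" by simp
qed simp

lemma eventually_at_left_lt: "eventually (\<lambda>s. s < y) (at_left (y::real))"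
  by (simp add: eventually_at_filter)

text \<open>Right-continuity gives one inequality at a finite quantile. Left-continuity gives the
  other, since \<open>F\<close> stays below \<open>u\<close> to the left of the infimum.\<close>

lemma uni_ext_gen_inv:
  assumes F: "uni_cdf F" "continuous_on UNIV F" and u: "0 \<le> u" "u \<le> 1"
  shows "uni_ext F (gen_inv F u) = u"
proof (cases "gen_inv F u")
  case (real y)
  have "(F \<longlongrightarrow> F y) (at_left y)"
    using F(2) by (metis UNIV_I continuous_on_def open_UNIV at_within_open tendsto_mono at_le subset_UNIV)
  moreover have "eventually (\<lambda>s. F s \<le> u) (at_left y)"
    using less_gen_inv[of _ F u] real eventually_at_left_lt[of y]
    by (auto elim!: eventually_mono intro: less_imp_le)
  ultimately have "F y \<le> u" by (rule tendsto_upperbound) simp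
  then show ?thesis using gen_inv_attained[OF F(1) real] real by simp
qed (use gen_inv_PInf[OF F(1), of u] gen_inv_MInf[OF F(1), of u] u in auto)

text \<open>The strict hypothesis holds eventually along truncations and the weak conclusion
  survives the limit. Hence the mixture of \<open><\<close> and \<open>\<le>\<close> in the
  moduli.\<close>

lemma uni_ext_modulus:
  assumes F: "uni_cdf F" and G: "uni_cdf G"
    and mod: "\<And>s t. \<bar>F s - F t\<bar> < \<delta> \<Longrightarrow> \<bar>r * (G s - F s) - r * (G t - F t)\<bar> \<le> \<epsilon>"
    and less: "\<bar>uni_ext F x - uni_ext F y\<bar> < \<delta>"
  shows "\<bar>r * (uni_ext G x - uni_ext F x) - r * (uni_ext G y - uni_ext F y)\<bar> \<le> \<epsilon>"
proof (rule tendsto_upperbound)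
  let ?t = ereal_trunc
  show "(\<lambda>k. \<bar>r * (G (?t k x) - F (?t k x)) - r * (G (?t k y) - F (?t k y))\<bar>) \<longlonglongrightarrow>
    \<bar>r * (uni_ext G x - uni_ext F x) - r * (uni_ext G y - uni_ext F y)\<bar>"
    by (intro tendsto_intros uni_ext_trunc_tendsto F G)
  have "(\<lambda>k. \<bar>F (?t k x) - F (?t k y)\<bar>) \<longlonglongrightarrow> \<bar>uni_ext F x - uni_ext F y\<bar>"
    by (intro tendsto_intros uni_ext_trunc_tendsto F)
  from order_tendstoD(2)[OF this less]
  show "eventually (\<lambda>k. \<bar>r * (G (?t k x) - F (?t k x)) - r * (G (?t k y) - F (?t k y))\<bar> \<le> \<epsilon>) sequentially"
    by eventually_elim (rule mod)
qed simp

text \<open>Continuity of \<open>F\<close> and the modulus bound force the jumps of \<open>r * G\<close> to be at most \<open>\<epsilon>\<close>.\<close>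

lemma uni_ext_gen_inv_approx:
  assumes F: "uni_cdf F" "continuous_on UNIV F" and G: "uni_cdf G" and u: "0 \<le> u" "u \<le> 1"
    and mod: "\<And>s t. \<bar>F s - F t\<bar> < \<delta> \<Longrightarrow> \<bar>r * (G s - F s) - r * (G t - F t)\<bar> \<le> \<epsilon>"
    and r: "0 < r" and \<delta>: "0 < \<delta>"
  shows "\<bar>r * (uni_ext G (gen_inv G u) - u)\<bar> \<le> \<epsilon>"
proof (cases "gen_inv G u")
  case (real y)
  have lim: "(F \<longlongrightarrow> F y) (at_left y)"
    using F(2) by (metis UNIV_I continuous_on_def open_UNIV at_within_open tendsto_mono at_le subset_UNIV)
  have "r * (G y - u) \<le> \<epsilon>"
  proof (rule tendsto_lowerbound)
    show "((\<lambda>s. \<epsilon> + r * (F y - F s)) \<longlongrightarrow> \<epsilon>) (at_left y)"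
      by (rule tendsto_eq_intros lim refl | simp)+
    have "eventually (\<lambda>s. F y - F s < \<delta>) (at_left y)"
      using order_tendstoD(1)[OF lim, of "F y - \<delta>"] \<delta> by (auto elim!: eventually_mono)
    then show "eventually (\<lambda>s. r * (G y - u) \<le> \<epsilon> + r * (F y - F s)) (at_left y)"
      using eventually_at_left_lt[of y]
    proof eventually_elim
      case (elim s)
      \<comment> \<open>Points left of the quantile lie below level \<open>u\<close>, so the
        overshoot at \<open>y\<close> is at most the increment of \<open>G\<close> from
        \<open>s\<close> to \<open>y\<close>; the modulus compares it with the increment of
        \<open>F\<close>, which vanishes as \<open>s\<close> approaches \<open>y\<close>.\<close>
      have "G s < u" using elim(2) real by (intro less_gen_inv) simp
      then have "r * (G y - u) \<le> r * (G y - G s)" using r by (intro mult_left_mono) auto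
      moreover have "\<bar>r * (G y - F y) - r * (G s - F s)\<bar> \<le> \<epsilon>"
        using elim uni_cdf_mono[OF F(1), of s y] by (intro mod) auto
      ultimately show ?case by (simp add: algebra_simps abs_le_iff)
    qed
  qed simp
  moreover have "0 \<le> r * (G y - u)" using gen_inv_attained[OF G real] r by simp
  ultimately show ?thesis by (simp add: real)
next
  \<comment> \<open>An infinite quantile leaves no error at all, and \<open>mod[of 0 0]\<close> only
    supplies that \<open>\<epsilon>\<close> is nonnegative.\<close>
  case PInf
  then show ?thesis using gen_inv_PInf[OF G PInf] u mod[of 0 0] \<delta> by simp
next
  case MInf
  then show ?thesis using gen_inv_MInf[OF G MInf] u mod[of 0 0] \<delta> by simp
qed

section \<open>Expansion of the hybrid copula estimator\<close>

lemma unit_cube_eq_cbox: "(unit_cube :: (real^'p::finite) set) = cbox 0 1"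
  by (auto simp: unit_cube_def mem_box_cart)

lemma compact_unit_cube: "compact (unit_cube :: (real^'p::finite) set)"
  by (simp add: unit_cube_eq_cbox)

lemma unit_cube_nonempty: "(unit_cube :: (real^'p::finite) set) \<noteq> {}"
  by (auto simp: unit_cube_def intro!: exI[of _ 0])

text \<open>A single pair of tolerances replaces a full modulus of continuity, so that membership is
  stable, up to constants, under uniform perturbation. This is what makes distances to the set
  useful.\<close>

definition equicont :: "('p \<Rightarrow> real \<Rightarrow> real) \<Rightarrow> real \<Rightarrow> real \<Rightarrow> real \<Rightarrow> ((real^'p::finite) + ('p \<times> real) \<Rightarrow> real) set" where
  "equicont F K \<delta> \<epsilon> = {f. (\<forall>i. \<bar>f i\<bar> \<le> K) \<and>
     (\<forall>x y. (\<forall>j. \<bar>F j (x$j) - F j (y$j)\<bar> < \<delta>) \<longrightarrow> \<bar>f (Inl x) - f (Inl y)\<bar> \<le> \<epsilon>) \<and>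
     (\<forall>j s t. \<bar>F j s - F j t\<bar> < \<delta> \<longrightarrow> \<bar>f (Inr (j, s)) - f (Inr (j, t))\<bar> \<le> \<epsilon>)}"

section \<open>The copula: Sklar's identity, Lipschitz bounds, mean value theorem\<close>

locale smooth_copula =
  fixes H :: "real^'p::finite \<Rightarrow> real" and F :: "'p \<Rightarrow> real \<Rightarrow> real" and D :: "'p \<Rightarrow> real^'p \<Rightarrow> real"
  assumes H_cdf: "mv_cdf H"
    and F_margin: "\<And>j. F j = margin H j"
    and F_cont: "\<And>j. continuous_on UNIV (F j)"
    and C_deriv: "\<And>j u. u \<in> unit_cube \<Longrightarrow> 0 < u$j \<Longrightarrow> u$j < 1 \<Longrightarrow>
        ((\<lambda>t. copula_of H F (\<chi> i. if i = j then t else u$i)) has_real_derivative D j u) (at (u$j))"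
    and D_cont: "\<And>j. continuous_on {u \<in> unit_cube. 0 < u$j \<and> u$j < 1} (D j)"
begin

abbreviation "C \<equiv> copula_of H F"

definition "law = (SOME \<mu>. mv_cdf_of \<mu> H)"

lemmas law = mv_cdf_some[OF H_cdf, folded law_def]

sublocale law: prob_space law by (rule law(1))

lemma F_eq: "F j t = measure law {y. y$j \<le> t}"
proof -
  have "{y :: real^'p. \<forall>i. ereal (y$i) \<le> (\<chi> i. if i = j then ereal t else \<infinity>) $ i} = {y. y$j \<le> t}"
    by auto
  then show ?thesis by (simp add: F_margin margin_def law(4))
qed

lemma F_cdf: "uni_cdf (F j)"
proof -
  have "(\<lambda>y. y$j) \<in> borel_measurable law"
    unfolding measurable_cong_sets[OF law(2) refl] by simp
  moreover have "space law = UNIV" using sets_eq_imp_space_eq[OF law(2)] by simp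
  ultimately have "real_distribution (distr law borel (\<lambda>y. y$j))" "F j = cdf (distr law borel (\<lambda>y. y$j))"
    by (auto simp: F_eq cdf_def measure_distr vimage_def)
  then show ?thesis unfolding uni_cdf_def by blast
qed

lemma measure_halfspace: "measure law {y. ereal (y$j) \<le> t} = uni_ext (F j) t"
proof -
  have "space law = UNIV" using sets_eq_imp_space_eq[OF law(2)] by simp
  then show ?thesis using law.prob_space by (cases t) (auto simp: F_eq)
qed

lemma uni_ext_F_gen_inv: "0 \<le> t \<Longrightarrow> t \<le> 1 \<Longrightarrow> uni_ext (F j) (gen_inv (F j) t) = t"
  by (rule uni_ext_gen_inv[OF F_cdf F_cont])

lemma F_gen_inv:
  assumes "0 < t" "t < 1"
  shows "F j (real_of_ereal (gen_inv (F j) t)) = t"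
  using uni_ext_F_gen_inv[of t j] assms by (cases "gen_inv (F j) t") simp_all

text \<open>The orthant at \<open>x\<close> is covered by the orthant at \<open>y\<close> and, for
  each \<open>j\<close>, the slab between \<open>y$j\<close> and \<open>x$j\<close>, whose mass is
  an increment of \<open>F j\<close>.\<close>

lemma cdf_ext_diff: "\<bar>cdf_ext H x - cdf_ext H y\<bar> \<le> (\<Sum>j\<in>UNIV. \<bar>uni_ext (F j) (x$j) - uni_ext (F j) (y$j)\<bar>)"
proof -
  have *: "cdf_ext H x \<le> cdf_ext H y + (\<Sum>j\<in>UNIV. \<bar>uni_ext (F j) (x$j) - uni_ext (F j) (y$j)\<bar>)" for x y
  proof -
    let ?h = "\<lambda>j t. {z :: real^'p. ereal (z$j) \<le> t}"
    let ?d = "\<lambda>j. ?h j (x$j) - ?h j (y$j)"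
    have h: "?h j t \<in> sets law" for j t using borel_ereal_halfspace law(2) by auto
    have o: "{z. \<forall>i. ereal (z$i) \<le> x$i} \<in> sets law" for x using borel_ereal_orthant law(2) by auto
    have d: "measure law (?d j) \<le> \<bar>uni_ext (F j) (x$j) - uni_ext (F j) (y$j)\<bar>" for j
    proof (cases "y$j \<le> x$j")
      case True
      then have "?h j (y$j) \<subseteq> ?h j (x$j)" by auto
      then show ?thesis by (simp add: law.finite_measure_Diff h measure_halfspace)
    next
      case False
      then have "?d j = {}" by auto
      then show ?thesis by (simp only: measure_empty abs_ge_zero)
    qed
    have "cdf_ext H x \<le> measure law ({z. \<forall>i. ereal (z$i) \<le> y$i} \<union> (\<Union>j. ?d j))"
      unfolding law(4) using h o by (intro law.finite_measure_mono) auto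
    also have "\<dots> \<le> measure law {z. \<forall>i. ereal (z$i) \<le> y$i} + measure law (\<Union>j. ?d j)"
      using h o by (intro measure_Un_le) auto
    also have "measure law (\<Union>j. ?d j) \<le> (\<Sum>j\<in>UNIV. measure law (?d j))"
      using h by (intro law.finite_measure_subadditive_finite) auto
    also have "\<dots> \<le> (\<Sum>j\<in>UNIV. \<bar>uni_ext (F j) (x$j) - uni_ext (F j) (y$j)\<bar>)"
      by (intro sum_mono d)
    finally show ?thesis by (simp add: law(4))
  qed
  show ?thesis using *[of x y] *[of y x] by (simp add: abs_le_iff abs_minus_commute)
qed

lemma uni_ext_F_in_unit_cube: "(\<chi> j. uni_ext (F j) (x$j)) \<in> unit_cube"
  using uni_ext_bounds[OF F_cdf] by (simp add: unit_cube_def)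

text \<open>Sklar's identity at extended points. The quantile of \<open>F j (x$j)\<close> may differ
  from \<open>x$j\<close> where \<open>F j\<close> is flat, but both have the same
  \<open>F j\<close>-value, and \<open>cdf_ext_diff\<close> then bounds the discrepancy by
  0.\<close>

lemma cdf_ext_eq_copula: "cdf_ext H x = C (\<chi> j. uni_ext (F j) (x$j))"
proof -
  have "\<bar>cdf_ext H x - C (\<chi> j. uni_ext (F j) (x$j))\<bar> \<le> 0"
    unfolding copula_of_def
    by (rule order_trans[OF cdf_ext_diff]) (simp add: uni_ext_F_gen_inv uni_ext_bounds[OF F_cdf])
  then show ?thesis by simp
qed

lemma copula_lipschitz:
  assumes "u \<in> unit_cube" "v \<in> unit_cube"
  shows "\<bar>C u - C v\<bar> \<le> (\<Sum>j\<in>UNIV. \<bar>u$j - v$j\<bar>)"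
  unfolding copula_of_def using assms
  by (intro order_trans[OF cdf_ext_diff]) (simp add: uni_ext_F_gen_inv unit_cube_def)

lemma copula_lipschitz_component:
  assumes "u \<in> unit_cube" "0 \<le> s" "s \<le> 1" "0 \<le> t" "t \<le> 1"
  shows "\<bar>C (\<chi> i. if i = j then s else u$i) - C (\<chi> i. if i = j then t else u$i)\<bar> \<le> \<bar>s - t\<bar>"
proof -
  have "\<bar>C (\<chi> i. if i = j then s else u$i) - C (\<chi> i. if i = j then t else u$i)\<bar>
      \<le> (\<Sum>i\<in>UNIV. if i = j then \<bar>s - t\<bar> else 0)"
    using assms by (intro order_trans[OF copula_lipschitz] sum_mono) (auto simp: unit_cube_def)
  then show ?thesis by simp
qed

text \<open>The difference quotients are bounded by 1 because \<open>C\<close> is 1-Lipschitz in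
  each coordinate.\<close>

lemma D_bound:
  assumes u: "u \<in> unit_cube" "0 < u$j" "u$j < 1"
  shows "\<bar>D j u\<bar> \<le> 1"
proof (rule tendsto_upperbound)
  define g where "g t = C (\<chi> i. if i = j then t else u$i)" for t
  show "((\<lambda>h. \<bar>(g (u$j + h) - g (u$j)) / h\<bar>) \<longlongrightarrow> \<bar>D j u\<bar>) (at 0)"
    using C_deriv[OF u] unfolding g_def[symmetric] DERIV_def by (rule tendsto_rabs)
  have lim: "((\<lambda>h. u$j + h) \<longlongrightarrow> u$j) (at 0)" by (rule tendsto_eq_intros | simp)+
  show "eventually (\<lambda>h. \<bar>(g (u$j + h) - g (u$j)) / h\<bar> \<le> 1) (at 0)"
    using order_tendstoD(1)[OF lim u(2)] order_tendstoD(2)[OF lim u(3)] eventually_neq_at_within[of 0]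
  proof eventually_elim
    case (elim h)
    have "\<bar>g (u$j + h) - g (u$j)\<bar> \<le> \<bar>u$j + h - u$j\<bar>"
      unfolding g_def using elim u by (intro copula_lipschitz_component) auto
    then show ?case using elim by (simp add: abs_divide divide_le_eq)
  qed
qed simp

text \<open>Either end of the segment may lie on a face, where no derivative is available. The
  Lipschitz property gives continuity up to the ends, and the intermediate point is
  interior.\<close>

lemma copula_mvt:
  assumes w: "w \<in> unit_cube" and b: "0 \<le> b" "b \<le> 1" and ne: "b \<noteq> w$j"
  shows "\<exists>t. 0 < t \<and> t < 1 \<and> \<bar>t - w$j\<bar> \<le> \<bar>b - w$j\<bar> \<and>
    C (\<chi> i. if i = j then b else w$i) - C w = (b - w$j) * D j (\<chi> i. if i = j then t else w$i)"
proof -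
  define g where "g t = C (\<chi> i. if i = j then t else w$i)" for t
  define a where "a = min b (w$j)"
  define c where "c = max b (w$j)"
  have w01: "0 \<le> w$j" "w$j \<le> 1" using w by (auto simp: unit_cube_def)
  have ac: "a < c" "0 \<le> a" "c \<le> 1" using ne b w01 by (auto simp: a_def c_def)
  have gw: "g (w$j) = C w"
  proof -
    have "(\<chi> i. if i = j then w$j else w$i) = w" by (simp add: vec_eq_iff)
    then show ?thesis by (simp add: g_def)
  qed
  have dg: "(g has_real_derivative D j (\<chi> i. if i = j then t else w$i)) (at t)" if "0 < t" "t < 1" for t
  proof -
    let ?w = "\<chi> i. if i = j then t else w$i"
    have "?w \<in> unit_cube" using that w by (auto simp: unit_cube_def)
    moreover have "(\<chi> i. if i = j then s else ?w$i) = (\<chi> i. if i = j then s else w$i)" for s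
      by (simp add: vec_eq_iff)
    ultimately show ?thesis using C_deriv[of ?w j] that by (simp add: g_def[abs_def])
  qed
  have "1-lipschitz_on {a..c} g"
    using ac w by (intro lipschitz_onI) (auto simp: dist_real_def g_def intro!: copula_lipschitz_component)
  then have "continuous_on {a..c} g" by (rule lipschitz_on_continuous_on)
  moreover have "g differentiable (at t)" if "a < t" "t < c" for t
    using dg[of t] that ac by (auto simp: real_differentiable_def)
  ultimately obtain l z where z: "a < z" "z < c" "DERIV g z :> l" "g c - g a = (c - a) * l"
    using MVT[OF ac(1)] by blast
  have "l = D j (\<chi> i. if i = j then z else w$i)"
    using DERIV_unique[OF z(3) dg[of z]] z ac by simp
  moreover have "g b - g (w$j) = (b - w$j) * l"
    using z(4) by (auto simp: a_def c_def max_def min_def algebra_simps split: if_splits)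
  ultimately have "C (\<chi> i. if i = j then b else w$i) - C w = (b - w$j) * D j (\<chi> i. if i = j then z else w$i)"
    by (simp add: gw[symmetric]) (simp add: g_def)
  then show ?thesis
    using z ac by (intro exI[of _ z]) (auto simp: a_def c_def)
qed

text \<open>Indexing by a sum type turns the product of the spaces of bounded functions into a
  single one whose supremum distance is the maximum over the factors.\<close>

definition emp_process :: "real \<Rightarrow> (real^'p \<Rightarrow> real) \<Rightarrow> ('p \<Rightarrow> real \<Rightarrow> real) \<Rightarrow> (real^'p) + ('p \<times> real) \<Rightarrow> real" where
  "emp_process r H' G = case_sum (\<lambda>x. r * (H' x - H x)) (\<lambda>(j, t). r * (G j t - F j t))"

definition linearization :: "real \<Rightarrow> (real^'p \<Rightarrow> real) \<Rightarrow> ('p \<Rightarrow> real \<Rightarrow> real) \<Rightarrow> real^'p \<Rightarrow> real" where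
  "linearization r H' G u = r * (cdf_ext H' (\<chi> j. gen_inv (F j) (u$j)) - C u)
     - (\<Sum>j\<in>UNIV. D j u * (r * (uni_ext (G j) (gen_inv (F j) (u$j)) - u$j)) * indicator {0<..<1} (u$j))"

text \<open>The indicator masks the faces on which \<open>D j\<close> carries no information, so the
  bound 1 on the derivative serves on the whole cube.\<close>

lemma D_indicator_bound: "u \<in> unit_cube \<Longrightarrow> \<bar>D j u * c * indicator {0<..<1} (u$j)\<bar> \<le> \<bar>c\<bar>"
  using D_bound[of u j] by (auto simp: indicator_def abs_mult intro: mult_left_le_one_le)

section \<open>Deterministic expansion for a well-behaved estimation process\<close>

context
  fixes r H' G K \<delta> \<epsilon>
  assumes H': "mv_cdf H'" and G: "\<And>j. uni_cdf (G j)"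
    and eq: "emp_process r H' G \<in> equicont F K \<delta> \<epsilon>"
begin

lemma emp_process_ext_bound: "\<bar>r * (uni_ext (G j) z - uni_ext (F j) z)\<bar> \<le> K"
proof (rule tendsto_upperbound)
  show "(\<lambda>k. \<bar>r * (G j (ereal_trunc k z) - F j (ereal_trunc k z))\<bar>) \<longlonglongrightarrow> \<bar>r * (uni_ext (G j) z - uni_ext (F j) z)\<bar>"
    by (intro tendsto_intros uni_ext_trunc_tendsto G F_cdf)
  have "\<bar>emp_process r H' G (Inr (j, t))\<bar> \<le> K" for t using eq by (simp add: equicont_def)
  then show "eventually (\<lambda>k. \<bar>r * (G j (ereal_trunc k z) - F j (ereal_trunc k z))\<bar> \<le> K) sequentially"
    by (simp add: emp_process_def)
qed simp

lemma emp_process_modulus: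
  assumes "\<bar>F j s - F j t\<bar> < \<delta>"
  shows "\<bar>r * (G j s - F j s) - r * (G j t - F j t)\<bar> \<le> \<epsilon>"
proof -
  have "\<bar>emp_process r H' G (Inr (j, s)) - emp_process r H' G (Inr (j, t))\<bar> \<le> \<epsilon>"
    using eq assms by (auto simp: equicont_def)
  then show ?thesis by (simp add: emp_process_def)
qed

lemma emp_process_ext_modulus:
  assumes "\<bar>uni_ext (F j) x - uni_ext (F j) y\<bar> < \<delta>"
  shows "\<bar>r * (uni_ext (G j) x - uni_ext (F j) x) - r * (uni_ext (G j) y - uni_ext (F j) y)\<bar> \<le> \<epsilon>"
  by (rule uni_ext_modulus[OF F_cdf G emp_process_modulus assms])

lemma emp_process_ext_modulus_joint:
  assumes less: "\<And>j. \<bar>uni_ext (F j) (x$j) - uni_ext (F j) (y$j)\<bar> < \<delta>"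
  shows "\<bar>r * (cdf_ext H' x - cdf_ext H x) - r * (cdf_ext H' y - cdf_ext H y)\<bar> \<le> \<epsilon>"
proof (rule tendsto_upperbound)
  let ?t = "\<lambda>k x. \<chi> i. ereal_trunc k (x$i)"
  show "(\<lambda>k. \<bar>r * (H' (?t k x) - H (?t k x)) - r * (H' (?t k y) - H (?t k y))\<bar>) \<longlonglongrightarrow>
    \<bar>r * (cdf_ext H' x - cdf_ext H x) - r * (cdf_ext H' y - cdf_ext H y)\<bar>"
    by (intro tendsto_intros cdf_ext_trunc_tendsto H' H_cdf)
  have "eventually (\<lambda>k. \<forall>j. \<bar>F j (?t k x $ j) - F j (?t k y $ j)\<bar> < \<delta>) sequentially"
  proof (intro eventually_all_finite)
    fix j
    have "(\<lambda>k. \<bar>F j (?t k x $ j) - F j (?t k y $ j)\<bar>) \<longlonglongrightarrow> \<bar>uni_ext (F j) (x$j) - uni_ext (F j) (y$j)\<bar>"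
      unfolding vec_lambda_beta by (intro tendsto_intros uni_ext_trunc_tendsto F_cdf)
    from order_tendstoD(2)[OF this less]
    show "eventually (\<lambda>k. \<bar>F j (?t k x $ j) - F j (?t k y $ j)\<bar> < \<delta>) sequentially" .
  qed
  then show "eventually (\<lambda>k. \<bar>r * (H' (?t k x) - H (?t k x)) - r * (H' (?t k y) - H (?t k y))\<bar> \<le> \<epsilon>) sequentially"
  proof eventually_elim
    case (elim k)
    then have "\<bar>emp_process r H' G (Inl (?t k x)) - emp_process r H' G (Inl (?t k y))\<bar> \<le> \<epsilon>"
      using eq unfolding equicont_def by blast
    then show ?case by (simp add: emp_process_def)
  qed
qed simp

text \<open>The error has three sources: moving the joint process from \<open>y\<close> to
  \<open>x\<close> costs \<open>\<epsilon>\<close>, linearizing \<open>C\<close> costs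
  \<open>6 * \<epsilon>\<close> per coordinate, and replacing the quantile displacement
  \<open>X j\<close> by \<open>- f j (x$j)\<close> costs \<open>2 * \<epsilon>\<close> per
  coordinate.\<close>

lemma hybrid_copula_expansion_bound:
  assumes r: "0 < r" and \<delta>: "0 < \<delta>" and small: "(K + \<epsilon>) / r < \<delta> / 2"
    and D_close: "\<And>j v w. v \<in> unit_cube \<Longrightarrow> w \<in> unit_cube \<Longrightarrow> v$j \<in> {\<delta>/2..1-\<delta>/2} \<Longrightarrow> w$j \<in> {\<delta>/2..1-\<delta>/2}
      \<Longrightarrow> (\<And>i. \<bar>w$i - v$i\<bar> \<le> (K + \<epsilon>) / r) \<Longrightarrow> (K + \<epsilon>) * \<bar>D j w - D j v\<bar> \<le> \<epsilon>"
    and u: "u \<in> unit_cube"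
  shows "\<bar>r * (copula_of H' G u - C u) - linearization r H' G u\<bar> \<le> (1 + 8 * real CARD('p)) * \<epsilon>"
proof -
  define x where "x = (\<chi> j. gen_inv (F j) (u$j))"
  define y where "y = (\<chi> j. gen_inv (G j) (u$j))"
  define v where "v = (\<chi> j. uni_ext (F j) (y$j))"
  define fH where "fH z = r * (cdf_ext H' z - cdf_ext H z)" for z
  define f where "f j z = r * (uni_ext (G j) z - uni_ext (F j) z)" for j z
  define X where "X j = r * (v$j - u$j)" for j
  have \<epsilon>: "0 \<le> \<epsilon>" using emp_process_modulus[of _ 0 0] \<delta> by simp
  have u01: "0 \<le> u$j" "u$j \<le> 1" for j using u by (auto simp: unit_cube_def)
  have v01: "0 \<le> v$j" "v$j \<le> 1" for j using uni_ext_bounds[OF F_cdf] by (auto simp: v_def)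
  have v: "v \<in> unit_cube" using v01 by (simp add: unit_cube_def)
  have Fx: "uni_ext (F j) (x$j) = u$j" for j using uni_ext_F_gen_inv[OF u01] by (simp add: x_def)
  have "\<bar>r * (uni_ext (G j) (y$j) - u$j)\<bar> \<le> \<epsilon>" for j
    unfolding y_def vec_lambda_beta
    by (rule uni_ext_gen_inv_approx[OF F_cdf F_cont G u01 emp_process_modulus r \<delta>])
  \<comment> \<open>This identity links estimated quantiles with marginal processes: since
    \<open>G\<close> at its own quantile is almost \<open>u$j\<close>, the displacement
    \<open>X j\<close> almost cancels \<open>f j (y$j)\<close>.\<close>
  moreover have "X j + f j (y$j) = r * (uni_ext (G j) (y$j) - u$j)" for j
    by (simp add: X_def f_def v_def algebra_simps)
  ultimately have Xy: "\<bar>X j + f j (y$j)\<bar> \<le> \<epsilon>" for j by simp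
  have XK: "\<bar>X j\<bar> \<le> K + \<epsilon>" for j
    using Xy[of j] emp_process_ext_bound[of j "y$j"] by (simp add: f_def)
  have vu: "\<bar>v$j - u$j\<bar> \<le> (K + \<epsilon>) / r" for j
    using XK[of j] r by (simp add: X_def abs_mult pos_le_divide_eq mult.commute)
  have vu\<delta>: "\<bar>v$j - u$j\<bar> < \<delta> / 2" for j using vu[of j] small by linarith
  have xy: "\<bar>uni_ext (F j) (x$j) - uni_ext (F j) (y$j)\<bar> < \<delta>" for j
    using vu\<delta>[of j] \<delta> by (simp add: Fx v_def abs_minus_commute)
  have fH_xy: "\<bar>fH x - fH y\<bar> \<le> \<epsilon>" unfolding fH_def by (rule emp_process_ext_modulus_joint[OF xy])
  have "\<bar>f j (x$j) - f j (y$j)\<bar> \<le> \<epsilon>" for j unfolding f_def by (rule emp_process_ext_modulus[OF xy])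
  then have Xx: "\<bar>X j + f j (x$j)\<bar> \<le> 2 * \<epsilon>" for j using Xy[of j] by (smt (verit))
  \<comment> \<open>Near a face the quantile is compared with an infinite point, where both
    distribution functions agree and \<open>f j\<close> is 0. This adds one
    \<open>\<epsilon>\<close> to the bound in \<open>Xx\<close>.\<close>
  have X_edge: "\<bar>X j\<bar> \<le> 3 * \<epsilon>" if "u$j < \<delta> \<or> 1 - \<delta> < u$j" for j
  proof -
    have "\<bar>f j (x$j)\<bar> \<le> \<epsilon>"
      using that
    proof
      assume "u$j < \<delta>"
      then have "\<bar>f j (x$j) - f j (-\<infinity>)\<bar> \<le> \<epsilon>"
        unfolding f_def by (intro emp_process_ext_modulus) (use Fx u01[of j] in simp)
      then show ?thesis by (simp add: f_def)
    next
      assume "1 - \<delta> < u$j"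
      then have "\<bar>f j (x$j) - f j \<infinity>\<bar> \<le> \<epsilon>"
        unfolding f_def by (intro emp_process_ext_modulus) (use Fx u01[of j] in simp)
      then show ?thesis by (simp add: f_def)
    qed
    then show ?thesis using Xx[of j] by linarith
  qed
  \<comment> \<open>Interpolates from \<open>u\<close> to \<open>v\<close> one coordinate at a time,
    since only partial derivatives are available.\<close>
  define w where "w A = (\<chi> i. if i \<in> A then v$i else u$i)" for A
  have w_cube: "w A \<in> unit_cube" for A using u01 v01 by (simp add: w_def unit_cube_def)
  \<comment> \<open>The 6 arises near a face: the increment of \<open>C\<close> and the derivative
    term are each bounded by \<open>\<bar>X j\<bar>\<close>, at most \<open>3 * \<epsilon>\<close>.
    Elsewhere the mean value theorem leaves only one \<open>\<epsilon>\<close>.\<close>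
  have step: "\<bar>r * (C (w (insert j A)) - C (w A)) - D j u * X j * indicator {0<..<1} (u$j)\<bar> \<le> 6 * \<epsilon>"
    if j: "j \<notin> A" for j A
  proof -
    have wj: "w A $ j = u$j" using j by (simp add: w_def)
    have ins: "w (insert j A) = (\<chi> i. if i = j then v$j else w A $ i)"
      using j by (auto simp: w_def vec_eq_iff)
    have id: "w A = (\<chi> i. if i = j then u$j else w A $ i)" using wj by (simp add: vec_eq_iff)
    show ?thesis
    proof (cases "u$j < \<delta> \<or> 1 - \<delta> < u$j")
      case True
      have "\<bar>C (w (insert j A)) - C (w A)\<bar> \<le> \<bar>v$j - u$j\<bar>"
        using copula_lipschitz_component[OF w_cube[of A] v01[of j] u01[of j], of j] by (simp add: ins id[symmetric])
      then have "\<bar>r * (C (w (insert j A)) - C (w A))\<bar> \<le> \<bar>X j\<bar>"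
        using r by (simp add: X_def abs_mult)
      moreover have "\<bar>D j u * X j * indicator {0<..<1} (u$j)\<bar> \<le> \<bar>X j\<bar>" by (rule D_indicator_bound[OF u])
      ultimately show ?thesis using X_edge[OF True] by linarith
    next
      case False
      show ?thesis
      proof (cases "v$j = u$j")
        case True
        then have "w (insert j A) = w A" using id by (simp only: ins True id[symmetric])
        then show ?thesis using True \<epsilon> by (simp add: X_def)
      next
        case ne: False
        then obtain t where t: "0 < t" "t < 1" "\<bar>t - u$j\<bar> \<le> \<bar>v$j - u$j\<bar>"
          "C (w (insert j A)) - C (w A) = (v$j - u$j) * D j (\<chi> i. if i = j then t else w A $ i)"
          using copula_mvt[OF w_cube[of A] v01[of j], of j] by (auto simp: wj ins)
        let ?z = "\<chi> i. if i = j then t else w A $ i"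
        have "(K + \<epsilon>) * \<bar>D j ?z - D j u\<bar> \<le> \<epsilon>"
        proof (rule D_close[OF u])
          show "?z \<in> unit_cube" using w_cube[of A] t by (auto simp: unit_cube_def)
          \<comment> \<open>Here \<open>u$j\<close> is at least \<open>\<delta>\<close> away from
            both ends and the intermediate point moves by less than \<open>\<delta>/2\<close>, so
            both stay in the slab where \<open>D j\<close> is controlled.\<close>
          show "u$j \<in> {\<delta>/2..1-\<delta>/2}" "?z$j \<in> {\<delta>/2..1-\<delta>/2}"
            unfolding atLeastAtMost_iff vec_lambda_beta
            using False le_less_trans[OF t(3) vu\<delta>] \<delta> by (simp_all, linarith+)
          show "\<bar>?z$i - u$i\<bar> \<le> (K + \<epsilon>) / r" for i
            using t(3) vu[of j] vu[of i] order_trans[OF abs_ge_zero vu[of j]] by (auto simp: w_def)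
        qed
        then have "\<bar>X j\<bar> * \<bar>D j ?z - D j u\<bar> \<le> \<epsilon>"
          using mult_right_mono[OF XK[of j], of "\<bar>D j ?z - D j u\<bar>"] by linarith
        moreover have "r * (C (w (insert j A)) - C (w A)) - D j u * X j * indicator {0<..<1} (u$j)
            = X j * (D j ?z - D j u)"
          using False \<delta> by (simp add: t(4) X_def algebra_simps indicator_def not_less)
        ultimately show ?thesis using \<epsilon> by (simp add: abs_mult)
      qed
    qed
  qed
  have tele: "\<bar>r * (C (w A) - C u) - (\<Sum>j\<in>A. D j u * X j * indicator {0<..<1} (u$j))\<bar> \<le> real (card A) * (6 * \<epsilon>)"
    for A :: "'p set"
  proof (induction A rule: finite_induct[OF finite])
    case 1
    have "w {} = u" by (simp add: w_def)
    then show ?case by simp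
  next
    case (2 j A)
    have "r * (C (w (insert j A)) - C u) - (\<Sum>j\<in>insert j A. D j u * X j * indicator {0<..<1} (u$j))
      = (r * (C (w A) - C u) - (\<Sum>j\<in>A. D j u * X j * indicator {0<..<1} (u$j)))
        + (r * (C (w (insert j A)) - C (w A)) - D j u * X j * indicator {0<..<1} (u$j))"
      using 2 by (simp add: algebra_simps)
    moreover have "real (card (insert j A)) * (6 * \<epsilon>) = real (card A) * (6 * \<epsilon>) + 6 * \<epsilon>"
      using 2 by (simp add: algebra_simps)
    ultimately show ?case using 2(3) step[OF 2(2)] by linarith
  qed
  have "w UNIV = v" by (simp add: w_def)
  then have C_exp: "\<bar>r * (C v - C u) - (\<Sum>j\<in>UNIV. D j u * X j * indicator {0<..<1} (u$j))\<bar> \<le> real CARD('p) * (6 * \<epsilon>)"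
    using tele[of UNIV] by simp
  have "\<bar>\<Sum>j\<in>UNIV. D j u * (X j + f j (x$j)) * indicator {0<..<1} (u$j)\<bar> \<le> (\<Sum>j\<in>(UNIV::'p set). 2 * \<epsilon>)"
    by (intro order_trans[OF sum_abs] sum_mono order_trans[OF D_indicator_bound[OF u]] Xx)
  then have Xf: "\<bar>\<Sum>j\<in>UNIV. D j u * (X j + f j (x$j)) * indicator {0<..<1} (u$j)\<bar> \<le> real CARD('p) * (2 * \<epsilon>)"
    by simp
  have Cy: "copula_of H' G u = cdf_ext H' y" by (simp add: copula_of_def y_def)
  have Hy: "cdf_ext H y = C v" unfolding v_def by (rule cdf_ext_eq_copula)
  have lhs: "r * (copula_of H' G u - C u) = fH y + r * (C v - C u)"
    unfolding fH_def Cy Hy by (simp add: algebra_simps)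
  have "cdf_ext H x = C u" by (simp add: x_def copula_of_def)
  moreover have "r * (uni_ext (G j) (x$j) - u$j) = f j (x$j)" for j by (simp add: f_def Fx)
  ultimately have lin: "linearization r H' G u = fH x - (\<Sum>j\<in>UNIV. D j u * f j (x$j) * indicator {0<..<1} (u$j))"
    by (simp add: linearization_def fH_def x_def)
  have "r * (copula_of H' G u - C u) - linearization r H' G u
    = (fH y - fH x) + (r * (C v - C u) - (\<Sum>j\<in>UNIV. D j u * X j * indicator {0<..<1} (u$j)))
      + (\<Sum>j\<in>UNIV. D j u * (X j + f j (x$j)) * indicator {0<..<1} (u$j))"
    unfolding lhs lin by (simp add: algebra_simps sum.distrib)
  moreover have "(1 + 8 * real CARD('p)) * \<epsilon> = \<epsilon> + real CARD('p) * (6 * \<epsilon>) + real CARD('p) * (2 * \<epsilon>)"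
    by (simp add: algebra_simps)
  ultimately show ?thesis using fH_xy C_exp Xf by linarith
qed

end

end

text \<open>Bumps only certify that the process is \<open>\<epsilon>\<close>-close to the set. Two
  replacements of \<open>f\<close> by \<open>g\<close> and the modulus of \<open>g\<close> make up
  the factor 3.\<close>

lemma equicont_near:
  assumes g: "g \<in> equicont F K \<delta> \<epsilon>" and f: "\<And>i. \<bar>f i - g i\<bar> \<le> \<epsilon>"
  shows "f \<in> equicont F (K + \<epsilon>) \<delta> (3 * \<epsilon>)"
proof -
  have "\<bar>f i\<bar> \<le> K + \<epsilon>" for i
  proof -
    have "\<bar>g i\<bar> \<le> K" using g by (simp add: equicont_def)
    then show ?thesis using f[of i] by linarith
  qed
  moreover have "\<bar>f i - f k\<bar> \<le> 3 * \<epsilon>" if "\<bar>g i - g k\<bar> \<le> \<epsilon>" for i k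
    using f[of i] f[of k] that by linarith
  ultimately show ?thesis using g unfolding equicont_def by auto
qed

lemma equicont_subset_linf: "equicont F K \<delta> \<epsilon> \<subseteq> linf UNIV"
  by (auto simp: equicont_def intro: linfI)

lemma uniform_modulus_unit_cube:
  fixes a :: "real^'p::finite \<Rightarrow> real"
  assumes "continuous_on unit_cube a" "0 < e"
  shows "\<exists>\<rho>>0. \<forall>u\<in>unit_cube. \<forall>v\<in>unit_cube. (\<forall>j. \<bar>u$j - v$j\<bar> < \<rho>) \<longrightarrow> \<bar>a u - a v\<bar> < e"
proof -
  have "uniformly_continuous_on unit_cube a"
    using compact_uniformly_continuous[OF assms(1) compact_unit_cube] .
  then obtain d where d: "0 < d" "\<And>x x'. x \<in> unit_cube \<Longrightarrow> x' \<in> unit_cube \<Longrightarrow> dist x' x < d \<Longrightarrow> dist (a x') (a x) < e"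
    using assms(2) by (auto elim: uniformly_continuous_onE)
  have "\<bar>a u - a v\<bar> < e" if uv: "u \<in> unit_cube" "v \<in> unit_cube" "\<forall>j. \<bar>u$j - v$j\<bar> < d / real CARD('p)" for u v
  proof -
    have "dist u v \<le> (\<Sum>j\<in>UNIV. \<bar>u$j - v$j\<bar>)"
      unfolding dist_norm using norm_le_l1_cart[of "u - v"] by simp
    also have "\<dots> < (\<Sum>j\<in>(UNIV::'p set). d / real CARD('p))"
      using uv(3) by (intro sum_strict_mono) auto
    finally show ?thesis using d(2)[OF uv(2,1)] by (simp add: dist_real_def)
  qed
  then show ?thesis using d(1) by (intro exI[of _ "d / real CARD('p)"]) auto
qed

context smooth_copula
begin

text \<open>The threshold for \<open>r\<close> depends only on the tolerances and on the modulus of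
  \<open>D\<close>, never on \<open>H'\<close> or \<open>G\<close>. This uniformity permits its use
  at every outcome of the good event.\<close>

lemma hybrid_copula_expansion:
  assumes "0 < \<delta>" "0 < \<epsilon>" "0 \<le> K"
  shows "eventually (\<lambda>r. \<forall>H' G. mv_cdf H' \<longrightarrow> (\<forall>j. uni_cdf (G j)) \<longrightarrow>
      emp_process r H' G \<in> equicont F K \<delta> \<epsilon> \<longrightarrow>
      (\<forall>u\<in>unit_cube. \<bar>r * (copula_of H' G u - C u) - linearization r H' G u\<bar> \<le> (1 + 8 * real CARD('p)) * \<epsilon>)) at_top"
proof -
  \<comment> \<open>A compact slab away from the two faces for coordinate \<open>j\<close>, on which
    \<open>D j\<close> is uniformly continuous. The tolerance chosen for it offsets the factor
    \<open>K + \<epsilon>\<close> by which derivatives get multiplied.\<close>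
  define Q where "Q j = {u \<in> unit_cube. \<delta>/2 \<le> u$j \<and> u$j \<le> 1 - \<delta>/2}" for j :: 'p
  have "\<exists>\<rho>>0. \<forall>u\<in>Q j. \<forall>w\<in>Q j. dist w u < \<rho> \<longrightarrow> dist (D j w) (D j u) < \<epsilon> / (K + \<epsilon>)" for j
  proof -
    have "Q j = unit_cube \<inter> ({u. \<delta>/2 \<le> u$j} \<inter> {u. u$j \<le> 1 - \<delta>/2})" by (auto simp: Q_def)
    then have "compact (Q j)"
      by (simp only:) (intro compact_Int_closed compact_unit_cube closed_Int closed_Collect_le continuous_intros)
    moreover have "continuous_on (Q j) (D j)"
      by (rule continuous_on_subset[OF D_cont]) (use assms in \<open>auto simp: Q_def\<close>)
    ultimately have "uniformly_continuous_on (Q j) (D j)" by (intro compact_uniformly_continuous)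
    then show ?thesis using assms unfolding uniformly_continuous_on_def by auto
  qed
  then obtain \<rho> where \<rho>: "\<And>j. 0 < \<rho> j"
    "\<And>j u w. u \<in> Q j \<Longrightarrow> w \<in> Q j \<Longrightarrow> dist w u < \<rho> j \<Longrightarrow> dist (D j w) (D j u) < \<epsilon> / (K + \<epsilon>)"
    by metis
  have lim: "((\<lambda>r. c / r) \<longlongrightarrow> 0) at_top" for c :: real
    by (rule tendsto_divide_0[OF tendsto_const filterlim_at_top_imp_at_infinity[OF filterlim_ident]])
  have "eventually (\<lambda>r. (K + \<epsilon>) / r < \<delta> / 2) at_top"
    using assms by (intro order_tendstoD(2)[OF lim]) auto
  \<comment> \<open>The number of coordinates enters through bounding Euclidean distance by the sum
    of coordinate distances.\<close>
  moreover have "eventually (\<lambda>r. \<forall>j. real CARD('p) * (K + \<epsilon>) / r < \<rho> j) at_top"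
    by (intro eventually_all_finite order_tendstoD(2)[OF lim] \<rho>)
  ultimately show ?thesis using eventually_gt_at_top[of 0]
  proof eventually_elim
    case (elim r)
    show ?case
    proof (intro allI impI ballI)
      fix H' :: "real^'p \<Rightarrow> real" and G :: "'p \<Rightarrow> real \<Rightarrow> real" and u :: "real^'p"
      assume A: "mv_cdf H'" "\<forall>j. uni_cdf (G j)" "emp_process r H' G \<in> equicont F K \<delta> \<epsilon>" "u \<in> unit_cube"
      show "\<bar>r * (copula_of H' G u - C u) - linearization r H' G u\<bar> \<le> (1 + 8 * real CARD('p)) * \<epsilon>"
      proof (rule hybrid_copula_expansion_bound[OF A(1) A(2)[rule_format] A(3) elim(3) assms(1) elim(1) _ A(4)])
        fix j and v w :: "real^'p"
        assume B: "v \<in> unit_cube" "w \<in> unit_cube" "v$j \<in> {\<delta>/2..1-\<delta>/2}" "w$j \<in> {\<delta>/2..1-\<delta>/2}"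
          "\<And>i. \<bar>w$i - v$i\<bar> \<le> (K + \<epsilon>) / r"
        have "dist w v \<le> (\<Sum>i\<in>UNIV. \<bar>w$i - v$i\<bar>)"
          unfolding dist_norm using norm_le_l1_cart[of "w - v"] by simp
        also have "\<dots> \<le> (\<Sum>i\<in>(UNIV::'p set). (K + \<epsilon>) / r)" by (intro sum_mono B)
        also have "\<dots> < \<rho> j" using elim(2) by simp
        finally have "dist (D j w) (D j v) < \<epsilon> / (K + \<epsilon>)"
          using B by (intro \<rho>) (auto simp: Q_def)
        then show "(K + \<epsilon>) * \<bar>D j w - D j v\<bar> \<le> \<epsilon>"
          using assms by (simp add: dist_real_def pos_less_divide_eq mult.commute)
      qed
    qed
  qed
qed

section \<open>Lipschitz approximations of the linearized process\<close>

text \<open>Replacing \<open>u\<close> by a point bounded away from the boundary of the cube keeps the quantiles finite, so that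
  \<open>lin_approx m\<close> acts on all of \<open>linf UNIV\<close>.\<close>

definition shrink :: "nat \<Rightarrow> real \<Rightarrow> real" where
  "shrink m t = max (1 / (real m + 3)) (min (1 - 1 / (real m + 3)) t)"

definition quant :: "nat \<Rightarrow> 'p \<Rightarrow> real \<Rightarrow> real" where
  "quant m j t = real_of_ereal (gen_inv (F j) (shrink m t))"

definition lin_approx :: "nat \<Rightarrow> ((real^'p) + ('p \<times> real) \<Rightarrow> real) \<Rightarrow> real^'p \<Rightarrow> real" where
  "lin_approx m f u = f (Inl (\<chi> j. quant m j (u$j)))
     - (\<Sum>j\<in>UNIV. D j u * f (Inr (j, quant m j (u$j))) * indicator {0<..<1} (u$j))"

lemma shrink_bounds: "0 < shrink m t" "shrink m t < 1"
proof -
  have "0 < 1 / (real m + 3)" "1 / (real m + 3) < 1" by (auto simp: field_simps)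
  then show "0 < shrink m t" "shrink m t < 1" unfolding shrink_def by linarith+
qed

text \<open>The offset 3 keeps \<open>1 / (real m + 3)\<close> below 1/2, so the clamping interval
  is nonempty, and strictly below \<open>1 / (real m + 1)\<close>, the radius at which the modulus
  is used.\<close>

lemma shrink_near:
  assumes "0 \<le> t" "t \<le> 1"
  shows "\<bar>shrink m t - t\<bar> < 1 / (real m + 1)"
proof -
  have "1 / (real m + 3) < 1 / (real m + 1)" "0 < 1 / (real m + 3)" "1 / (real m + 3) < 1 / 2"
    by (auto simp: field_simps)
  then show ?thesis using assms unfolding shrink_def by linarith
qed

lemma F_quant [simp]: "F j (quant m j t) = shrink m t"
  unfolding quant_def by (rule F_gen_inv[OF shrink_bounds])

lemma lin_approx_diff:
  assumes u: "u \<in> unit_cube" and fg: "\<And>i. \<bar>f i - g i\<bar> \<le> d"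
  shows "\<bar>lin_approx m f u - lin_approx m g u\<bar> \<le> (1 + real CARD('p)) * d"
proof -
  let ?q = "\<lambda>j. quant m j (u$j)"
  have "lin_approx m f u - lin_approx m g u = (f (Inl (\<chi> j. ?q j)) - g (Inl (\<chi> j. ?q j)))
      - (\<Sum>j\<in>UNIV. D j u * (f (Inr (j, ?q j)) - g (Inr (j, ?q j))) * indicator {0<..<1} (u$j))"
    by (simp add: lin_approx_def algebra_simps sum.distrib sum_subtractf)
  moreover have "\<bar>\<Sum>j\<in>UNIV. D j u * (f (Inr (j, ?q j)) - g (Inr (j, ?q j))) * indicator {0<..<1} (u$j)\<bar>
      \<le> (\<Sum>j\<in>(UNIV::'p set). d)"
    by (intro order_trans[OF sum_abs] sum_mono order_trans[OF D_indicator_bound[OF u]] fg)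
  ultimately show ?thesis using fg[of "Inl (\<chi> j. ?q j)"] by (simp add: algebra_simps)
qed

lemma lin_approx_linf:
  assumes "f \<in> linf UNIV"
  shows "lin_approx m f \<in> linf unit_cube"
proof -
  obtain B where B: "\<And>i. \<bar>f i\<bar> \<le> B" using linf_bounded[OF assms] by auto
  show ?thesis
  proof (rule linfI)
    fix u :: "real^'p" assume u: "u \<in> unit_cube"
    have "\<bar>lin_approx m f u - lin_approx m (\<lambda>_. 0) u\<bar> \<le> (1 + real CARD('p)) * B"
      by (rule lin_approx_diff[OF u]) (simp add: B)
    then show "\<bar>lin_approx m f u\<bar> \<le> (1 + real CARD('p)) * B" by (simp add: lin_approx_def)
  qed
qed

lemma lin_approx_lipschitz:
  assumes "f \<in> linf UNIV" "g \<in> linf UNIV"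
  shows "linf_dist unit_cube (lin_approx m f) (lin_approx m g) \<le> (1 + real CARD('p)) * linf_dist UNIV f g"
  by (intro linf_dist_le unit_cube_nonempty lin_approx_diff abs_diff_le_linf_dist assms) auto

text \<open>Clamping moves every \<open>F\<close>-value by less than the radius of the modulus, so
  the joint term and each of the marginal terms changes by at most
  \<open>\<epsilon>\<close>.\<close>

lemma linearization_near_lin_approx:
  assumes H': "mv_cdf H'" and G: "\<And>j. uni_cdf (G j)"
    and eq: "emp_process r H' G \<in> equicont F K (1 / (real m + 1)) \<epsilon>" and u: "u \<in> unit_cube"
  shows "\<bar>linearization r H' G u - lin_approx m (emp_process r H' G) u\<bar> \<le> (1 + real CARD('p)) * \<epsilon>"
proof -
  let ?q = "\<lambda>j. quant m j (u$j)"
  define x where "x = (\<chi> j. gen_inv (F j) (u$j))"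
  define y where "y = (\<chi> j. ereal (?q j))"
  have u01: "0 \<le> u$j" "u$j \<le> 1" for j using u by (auto simp: unit_cube_def)
  have Fx: "uni_ext (F j) (x$j) = u$j" for j using uni_ext_F_gen_inv[OF u01] by (simp add: x_def)
  have xy: "\<bar>uni_ext (F j) (x$j) - uni_ext (F j) (y$j)\<bar> < 1 / (real m + 1)" for j
    using shrink_near[OF u01, of m j] by (simp add: Fx y_def abs_minus_commute)
  define f where "f j z = r * (uni_ext (G j) z - uni_ext (F j) z)" for j z
  define fH where "fH z = r * (cdf_ext H' z - cdf_ext H z)" for z
  have ext: "cdf_ext K y = K (\<chi> j. ?q j)" if "mv_cdf K" for K
    using mv_cdf_some[OF that] by (simp add: y_def)
  have 1: "\<bar>fH x - fH y\<bar> \<le> \<epsilon>"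
    unfolding fH_def by (rule emp_process_ext_modulus_joint[OF H' G eq xy])
  have 2: "\<bar>f j (x$j) - f j (y$j)\<bar> \<le> \<epsilon>" for j
    unfolding f_def by (rule emp_process_ext_modulus[OF H' G eq xy])
  have "cdf_ext H x = C u" by (simp add: x_def copula_of_def)
  moreover have "r * (uni_ext (G j) (x$j) - u$j) = f j (x$j)" for j by (simp add: f_def Fx)
  ultimately have lin: "linearization r H' G u = fH x - (\<Sum>j\<in>UNIV. D j u * f j (x$j) * indicator {0<..<1} (u$j))"
    by (simp add: linearization_def fH_def x_def)
  have app: "lin_approx m (emp_process r H' G) u = fH y - (\<Sum>j\<in>UNIV. D j u * f j (y$j) * indicator {0<..<1} (u$j))"
    by (simp add: lin_approx_def emp_process_def fH_def f_def ext H' H_cdf) (simp add: y_def)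
  have "linearization r H' G u - lin_approx m (emp_process r H' G) u = (fH x - fH y)
      - (\<Sum>j\<in>UNIV. D j u * (f j (x$j) - f j (y$j)) * indicator {0<..<1} (u$j))"
    unfolding lin app by (simp add: algebra_simps sum.distrib sum_subtractf)
  moreover have "\<bar>\<Sum>j\<in>UNIV. D j u * (f j (x$j) - f j (y$j)) * indicator {0<..<1} (u$j)\<bar>
      \<le> (\<Sum>j\<in>(UNIV::'p set). \<epsilon>)"
    by (intro order_trans[OF sum_abs] sum_mono order_trans[OF D_indicator_bound[OF u]] 2)
  ultimately show ?thesis using 1 by (simp add: algebra_simps)
qed

section \<open>Regularity of the limit process\<close>

lemma uni_ext_F_surj:
  "(\<lambda>x :: ereal^'p. \<chi> j. uni_ext (F j) (x$j)) ` UNIV = unit_cube"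
  "uni_ext (F j) ` UNIV = {0..1}"
proof -
  have "u \<in> range (\<lambda>x :: ereal^'p. \<chi> j. uni_ext (F j) (x$j))" if "u \<in> unit_cube" for u
    using that by (intro image_eqI[of _ _ "\<chi> j. gen_inv (F j) (u$j)"])
      (auto simp: vec_eq_iff uni_ext_F_gen_inv unit_cube_def)
  then show "(\<lambda>x :: ereal^'p. \<chi> j. uni_ext (F j) (x$j)) ` UNIV = unit_cube"
    using uni_ext_F_in_unit_cube by auto
  have "t \<in> range (uni_ext (F j))" if "t \<in> {0..1}" for t
    using that by (intro image_eqI[of _ _ "gen_inv (F j) t"]) (auto simp: uni_ext_F_gen_inv)
  then show "uni_ext (F j) ` UNIV = {0..1}" using uni_ext_bounds[OF F_cdf] by auto
qed

text \<open>A monotone map onto an interval cannot jump: a level strictly between is attained at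
  some \<open>s\<close>, and monotonicity controls the whole side of \<open>s\<close> containing
  \<open>x\<close>.\<close>

lemma continuous_uni_ext_F: "continuous_on UNIV (uni_ext (F j))"
proof -
  have mono: "mono (uni_ext (F j))"
  proof (rule monoI)
    fix s t :: ereal assume "s \<le> t"
    then show "uni_ext (F j) s \<le> uni_ext (F j) t"
      using uni_cdf_mono[OF F_cdf] uni_cdf_bounds[OF F_cdf] by (cases s; cases t) auto
  qed
  show ?thesis
    unfolding continuous_on_def
  proof (intro ballI order_tendstoI)
    fix x :: ereal and a assume a: "a < uni_ext (F j) x"
    \<comment> \<open>For negative \<open>a\<close> the level 0 works at once, because
      \<open>uni_ext\<close> is nonnegative; otherwise \<open>c\<close> lies strictly between and is
      an attained level.\<close>
    obtain c where c: "max a 0 \<le> c" "c \<le> uni_ext (F j) x" "a < c" "c < uni_ext (F j) x \<or> c = 0 \<and> a < 0"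
      using dense[OF a] uni_ext_bounds[OF F_cdf, of j x] by (cases "a < 0") (auto intro: that[of 0])
    have "eventually (\<lambda>t. c \<le> uni_ext (F j) t) (at x within UNIV)"
      using c(4)
    proof
      assume less: "c < uni_ext (F j) x"
      then obtain s where s: "c = uni_ext (F j) s"
        using uni_ext_F_surj(2)[of j] c(1) uni_ext_bounds[OF F_cdf, of j x] by (metis atLeastAtMost_iff imageE less_imp_le max.bounded_iff order_trans)
      then have "s < x" using monoD[OF mono, of x s] less by (meson not_le)
      from order_tendstoD(1)[OF tendsto_ident_at this] show ?thesis
        by eventually_elim (use s monoD[OF mono] in auto)
    qed (use uni_ext_bounds[OF F_cdf] in auto)
    then show "eventually (\<lambda>t. a < uni_ext (F j) t) (at x within UNIV)"
      by eventually_elim (use c in linarith)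
  next
    fix x :: ereal and a assume a: "uni_ext (F j) x < a"
    obtain c where c: "c \<le> min a 1" "c < a" "uni_ext (F j) x < c \<or> c = 1 \<and> 1 < a"
      using dense[OF a] uni_ext_bounds[OF F_cdf, of j x] by (cases "1 < a") (auto intro: that[of 1])
    have "eventually (\<lambda>t. uni_ext (F j) t \<le> c) (at x within UNIV)"
      using c(3)
    proof
      assume less: "uni_ext (F j) x < c"
      then obtain s where s: "c = uni_ext (F j) s"
        using uni_ext_F_surj(2)[of j] c(1) uni_ext_bounds[OF F_cdf, of j x] by (metis atLeastAtMost_iff imageE less_imp_le min.bounded_iff order_trans)
      then have "x < s" using monoD[OF mono, of s x] less by (meson not_le)
      from order_tendstoD(2)[OF tendsto_ident_at this] show ?thesis
        by eventually_elim (use s monoD[OF mono] in auto)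
    qed (use uni_ext_bounds[OF F_cdf] in auto)
    then show "eventually (\<lambda>t. uni_ext (F j) t < a) (at x within UNIV)"
      by eventually_elim (use c in linarith)
  qed
qed

text \<open>Compactness of the extended space is essential here: it makes the coordinatewise map
  \<open>F\<close> a quotient map onto the cube, through which continuity descends.\<close>

lemma continuous_on_unit_cube_of_ereal:
  assumes "continuous_on UNIV (\<lambda>x::ereal^'p. a (\<chi> j. uni_ext (F j) (x$j)))"
  shows "continuous_on unit_cube (a :: real^'p \<Rightarrow> real)"
proof -
  have "continuous_on UNIV (\<lambda>x::ereal^'p. \<chi> j. uni_ext (F j) (x$j))"
    by (intro continuous_on_vec_lambda continuous_on_compose2[OF continuous_uni_ext_F] continuous_on_component) auto
  from continuous_on_compact_quotient[OF compact_UNIV_ereal_vec this assms]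
  show ?thesis by (simp add: uni_ext_F_surj)
qed

lemma continuous_on_unit_interval_of_ereal:
  assumes "continuous_on UNIV (\<lambda>t. b (uni_ext (F j) t))"
  shows "continuous_on {0..1} (b :: real \<Rightarrow> real)"
  using continuous_on_compact_quotient[OF compact_UNIV continuous_uni_ext_F assms]
  by (simp add: uni_ext_F_surj)

lemma F_in_unit_interval: "F j t \<in> {0..1}"
  using uni_cdf_bounds[OF F_cdf] by simp

lemma F_in_unit_cube: "(\<chi> j. F j (x$j)) \<in> unit_cube"
  using F_in_unit_interval by (simp add: unit_cube_def)

definition limit_process :: "(real^'p \<Rightarrow> real) \<Rightarrow> ('p \<Rightarrow> real \<Rightarrow> real) \<Rightarrow> (real^'p) + ('p \<times> real) \<Rightarrow> real" where
  "limit_process a b = case_sum (\<lambda>x. a (\<chi> j. F j (x$j))) (\<lambda>(j, t). b j (F j t))"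

context
  fixes a :: "real^'p \<Rightarrow> real" and b :: "'p \<Rightarrow> real \<Rightarrow> real"
  assumes a: "continuous_on unit_cube a" and b: "\<And>j. continuous_on {0..1} (b j)"
begin

text \<open>Uniform continuity on compact sets; having finitely many coordinates allows one
  \<open>m\<close> for all of them.\<close>

lemma limit_modulus:
  assumes e: "0 < e"
  shows "eventually (\<lambda>m. (\<forall>u\<in>unit_cube. \<forall>v\<in>unit_cube. (\<forall>j. \<bar>u$j - v$j\<bar> < 1 / (real m + 1)) \<longrightarrow> \<bar>a u - a v\<bar> < e) \<and>
    (\<forall>j. \<forall>s\<in>{0..1}. \<forall>t\<in>{0..1}. \<bar>s - t\<bar> < 1 / (real m + 1) \<longrightarrow> \<bar>b j s - b j t\<bar> < e)) sequentially"
proof -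
  obtain \<rho> where \<rho>: "0 < \<rho>" "\<forall>u\<in>unit_cube. \<forall>v\<in>unit_cube. (\<forall>j. \<bar>u$j - v$j\<bar> < \<rho>) \<longrightarrow> \<bar>a u - a v\<bar> < e"
    using uniform_modulus_unit_cube[OF a e] by blast
  have "\<exists>\<sigma>>0. \<forall>s\<in>{0..1}. \<forall>t\<in>{0..1}. \<bar>s - t\<bar> < \<sigma> \<longrightarrow> \<bar>b j s - b j t\<bar> < e" for j
  proof -
    have "uniformly_continuous_on {0..1} (b j)" by (rule compact_uniformly_continuous[OF b]) simp
    then show ?thesis using e unfolding uniformly_continuous_on_def dist_real_def by meson
  qed
  then obtain \<sigma> where \<sigma>: "\<And>j. 0 < \<sigma> j"
    "\<And>j s t. s \<in> {0..1} \<Longrightarrow> t \<in> {0..1} \<Longrightarrow> \<bar>s - t\<bar> < \<sigma> j \<Longrightarrow> \<bar>b j s - b j t\<bar> < e"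
    by metis
  have lim: "(\<lambda>m. 1 / (real m + 1)) \<longlonglongrightarrow> 0"
    using LIMSEQ_inverse_real_of_nat by (simp add: inverse_eq_divide add.commute)
  have "eventually (\<lambda>m. \<forall>j. 1 / (real m + 1) < \<sigma> j) sequentially"
    by (intro eventually_all_finite order_tendstoD(2)[OF lim] \<sigma>)
  with order_tendstoD(2)[OF lim \<rho>(1)] show ?thesis
  proof eventually_elim
    case (elim m)
    have "\<bar>a u - a v\<bar> < e" if "u \<in> unit_cube" "v \<in> unit_cube" "\<forall>j. \<bar>u$j - v$j\<bar> < 1 / (real m + 1)" for u v
      using \<rho>(2) that elim(1) by (meson less_trans)
    moreover have "\<bar>b j s - b j t\<bar> < e" if "s \<in> {0..1}" "t \<in> {0..1}" "\<bar>s - t\<bar> < 1 / (real m + 1)" for j s t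
      using \<sigma>(2)[OF that(1,2)] that(3) elim(2) by (meson less_trans)
    ultimately show ?case by blast
  qed
qed

lemma limit_process_bounded: "\<exists>B. \<forall>i. \<bar>limit_process a b i\<bar> \<le> B"
proof -
  have "bounded (a ` unit_cube)"
    by (intro compact_imp_bounded compact_continuous_image a compact_unit_cube)
  then obtain B where B: "\<And>u. u \<in> unit_cube \<Longrightarrow> \<bar>a u\<bar> \<le> B" by (auto simp: bounded_iff)
  have "bounded (\<Union>j. b j ` {0..1})"
    by (intro bounded_UN ballI compact_imp_bounded compact_continuous_image b) auto
  then obtain B' where "\<forall>j. \<forall>t\<in>{0..1}. \<bar>b j t\<bar> \<le> B'" by (auto simp: bounded_iff)
  then have B': "\<And>j t. t \<in> {0..1} \<Longrightarrow> \<bar>b j t\<bar> \<le> B'" by blast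
  have "\<bar>limit_process a b i\<bar> \<le> max B B'" for i
    using B[OF F_in_unit_cube] B'[OF F_in_unit_interval]
    by (cases i) (auto simp: limit_process_def split: prod.split intro: max.coboundedI1 max.coboundedI2)
  then show ?thesis by blast
qed

lemma limit_process_equicont:
  assumes "0 < \<epsilon>"
  shows "eventually (\<lambda>m. limit_process a b \<in> equicont F (real m) (1 / (real m + 1)) \<epsilon>) sequentially"
proof -
  obtain B where B: "\<And>i. \<bar>limit_process a b i\<bar> \<le> B" using limit_process_bounded by blast
  have "eventually (\<lambda>m. B \<le> real m) sequentially"
    using filterlim_real_sequentially by (simp add: filterlim_at_top)
  with limit_modulus[OF assms] show ?thesis
  proof eventually_elim
    case (elim m)
    have "\<bar>limit_process a b i\<bar> \<le> real m" for i using B[of i] elim(2) by linarith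
    moreover have "\<bar>limit_process a b (Inl x) - limit_process a b (Inl y)\<bar> \<le> \<epsilon>"
      if "\<forall>j. \<bar>F j (x$j) - F j (y$j)\<bar> < 1 / (real m + 1)" for x y
      using elim(1) F_in_unit_cube[of x] F_in_unit_cube[of y] that
      by (auto simp: limit_process_def intro: less_imp_le)
    moreover have "\<bar>limit_process a b (Inr (j, s)) - limit_process a b (Inr (j, t))\<bar> \<le> \<epsilon>"
      if "\<bar>F j s - F j t\<bar> < 1 / (real m + 1)" for j s t
    proof -
      have "\<bar>b j (F j s) - b j (F j t)\<bar> < \<epsilon>"
        using elim(1) F_in_unit_interval[of j s] F_in_unit_interval[of j t] that by blast
      then show ?thesis by (simp add: limit_process_def)
    qed
    ultimately show ?case unfolding equicont_def by blast
  qed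
qed

text \<open>\<open>b j 0\<close> and \<open>b j 1\<close> are the limits of
  \<open>b j (F j t)\<close> at the two ends of the line. A function with zero tails that is
  uniformly \<open>e\<close>-close forces these limits to be at most \<open>e\<close> in absolute
  value.\<close>

lemma limit_vanishes_at_endpoints:
  assumes near: "\<And>e. 0 < e \<Longrightarrow> \<exists>g\<in>linf UNIV. ((\<lambda>t. g (Inr (j, t))) \<longlongrightarrow> 0) at_bot \<and>
      ((\<lambda>t. g (Inr (j, t))) \<longlongrightarrow> 0) at_top \<and> linf_dist UNIV (limit_process a b) g < e"
  shows "b j 0 = 0" "b j 1 = 0"
proof -
  have lp: "limit_process a b \<in> linf UNIV" using limit_process_bounded by (auto intro: linfI)
  have "((\<lambda>t. b j (F j t)) \<longlongrightarrow> b j 0) at_bot"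
    by (rule continuous_on_tendsto_compose[OF b uni_cdf_at_bot[OF F_cdf]])
      (use F_in_unit_interval in auto)
  moreover have "((\<lambda>t. b j (F j t)) \<longlongrightarrow> b j 1) at_top"
    by (rule continuous_on_tendsto_compose[OF b uni_cdf_at_top[OF F_cdf]])
      (use F_in_unit_interval in auto)
  \<comment> \<open>Stated for a general filter so as to serve both ends.\<close>
  moreover have "c = 0" if c: "((\<lambda>t. b j (F j t)) \<longlongrightarrow> c) net" and net: "net \<noteq> bot"
    and g: "\<And>e. 0 < e \<Longrightarrow> \<exists>g\<in>linf UNIV. ((\<lambda>t. g (Inr (j, t))) \<longlongrightarrow> 0) net \<and> linf_dist UNIV (limit_process a b) g < e"
    for c net
  proof -
    have "\<bar>c\<bar> \<le> 0 + e" if e: "0 < e" for e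
    proof -
      obtain g where g: "g \<in> linf UNIV" "((\<lambda>t. g (Inr (j, t))) \<longlongrightarrow> 0) net" "linf_dist UNIV (limit_process a b) g < e"
        using g[OF e] by blast
      have "((\<lambda>t. \<bar>b j (F j t) - g (Inr (j, t))\<bar>) \<longlongrightarrow> \<bar>c - 0\<bar>) net"
        by (intro tendsto_intros c g)
      moreover have "\<bar>b j (F j t) - g (Inr (j, t))\<bar> \<le> e" for t
        using abs_diff_le_linf_dist[OF lp g(1), of "Inr (j, t)"] g(3) by (simp add: limit_process_def)
      ultimately have "\<bar>c - 0\<bar> \<le> e"
        by (intro tendsto_upperbound[OF _ _ net]) (auto intro: always_eventually)
      then show ?thesis by simp
    qed
    then have "\<bar>c\<bar> \<le> 0" by (rule field_le_epsilon)
    then show ?thesis by simp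
  qed
  ultimately show "b j 0 = 0" "b j 1 = 0" using near by (meson trivial_limit_at_bot_linorder trivial_limit_at_top_linorder)+
qed

text \<open>For a limit trajectory the approximation merely replaces \<open>u\<close> by its clamped
  version inside \<open>a\<close> and \<open>b\<close>, so uniform continuity applies;
  \<open>D\<close> is still evaluated at \<open>u\<close> itself.\<close>

lemma lin_approx_limit_process:
  assumes b0: "\<And>j. b j 0 = 0" and b1: "\<And>j. b j 1 = 0" and e: "0 < e"
  shows "eventually (\<lambda>m. \<forall>u\<in>unit_cube.
    \<bar>lin_approx m (limit_process a b) u - (a u - (\<Sum>j\<in>UNIV. D j u * b j (u$j)))\<bar> \<le> e) sequentially"
proof -
  define d where "d = e / (1 + real CARD('p))"
  have d: "0 < d" using e by (simp add: d_def)
  show ?thesis using limit_modulus[OF d]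
  proof eventually_elim
    case (elim m)
    show ?case
    proof
      fix u :: "real^'p" assume u: "u \<in> unit_cube"
      define v where "v = (\<chi> j. shrink m (u$j))"
      have u01: "0 \<le> u$j" "u$j \<le> 1" for j using u by (auto simp: unit_cube_def)
      have v: "v \<in> unit_cube" using shrink_bounds by (auto simp: unit_cube_def v_def intro: less_imp_le)
      have vu: "\<bar>v$j - u$j\<bar> < 1 / (real m + 1)" for j using shrink_near[OF u01] by (simp add: v_def)
      have va: "\<bar>a v - a u\<bar> < d" using elim v u vu by blast
      have vb: "\<bar>b j (v$j) - b j (u$j)\<bar> < d" for j
        using elim vu[of j] v u01[of j] unfolding unit_cube_def by auto
      \<comment> \<open>On the faces \<open>D j u\<close> is an arbitrary value, but it multiplies
        \<open>b j\<close> at 0 or 1, which is 0.\<close>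
      have ind: "D j u * b j (u$j) = D j u * b j (u$j) * indicator {0<..<1} (u$j)" for j
        using u01[of j] b0[of j] b1[of j] by (cases "u$j = 0"; cases "u$j = 1") (auto simp: indicator_def)
      have "lin_approx m (limit_process a b) u = a v - (\<Sum>j\<in>UNIV. D j u * b j (v$j) * indicator {0<..<1} (u$j))"
        by (simp add: lin_approx_def limit_process_def v_def)
      moreover have "(\<Sum>j\<in>UNIV. D j u * b j (u$j)) = (\<Sum>j\<in>UNIV. D j u * b j (u$j) * indicator {0<..<1} (u$j))"
        by (intro sum.cong refl ind)
      ultimately have "lin_approx m (limit_process a b) u - (a u - (\<Sum>j\<in>UNIV. D j u * b j (u$j)))
          = (a v - a u) - (\<Sum>j\<in>UNIV. D j u * (b j (v$j) - b j (u$j)) * indicator {0<..<1} (u$j))"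
        by (simp add: algebra_simps sum.distrib sum_subtractf)
      moreover have "\<bar>\<Sum>j\<in>UNIV. D j u * (b j (v$j) - b j (u$j)) * indicator {0<..<1} (u$j)\<bar> \<le> (\<Sum>j\<in>(UNIV::'p set). d)"
        by (intro order_trans[OF sum_abs] sum_mono order_trans[OF D_indicator_bound[OF u]] less_imp_le[OF vb])
      moreover have "d + real CARD('p) * d = e"
      proof -
        have "d + real CARD('p) * d = (1 + real CARD('p)) * d" by (simp add: algebra_simps)
        also have "\<dots> = e" by (simp add: d_def add_nonneg_eq_0_iff)
        finally show ?thesis .
      qed
      ultimately show "\<bar>lin_approx m (limit_process a b) u - (a u - (\<Sum>j\<in>UNIV. D j u * b j (u$j)))\<bar> \<le> e"
        using va by simp
    qed
  qed
qed

end

lemma emp_process_tails: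
  assumes "uni_cdf (G j)"
  shows "((\<lambda>t. emp_process r H' G (Inr (j, t))) \<longlongrightarrow> 0) at_bot"
    and "((\<lambda>t. emp_process r H' G (Inr (j, t))) \<longlongrightarrow> 0) at_top"
proof -
  have "((\<lambda>t. r * (G j t - F j t)) \<longlongrightarrow> r * (0 - 0)) at_bot"
    by (intro tendsto_intros uni_cdf_at_bot F_cdf assms)
  then show "((\<lambda>t. emp_process r H' G (Inr (j, t))) \<longlongrightarrow> 0) at_bot" by (simp add: emp_process_def)
  have "((\<lambda>t. r * (G j t - F j t)) \<longlongrightarrow> r * (1 - 1)) at_top"
    by (intro tendsto_intros uni_cdf_at_top F_cdf assms)
  then show "((\<lambda>t. emp_process r H' G (Inr (j, t))) \<longlongrightarrow> 0) at_top" by (simp add: emp_process_def)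
qed

end

theorem theorem2p3:
  fixes H :: "real^'p::finite \<Rightarrow> real"
    and F :: "'p \<Rightarrow> real \<Rightarrow> real"
    and D :: "'p \<Rightarrow> real^'p \<Rightarrow> real"
    and M :: "nat \<Rightarrow> 'a measure"
    and Hhat :: "nat \<Rightarrow> 'a \<Rightarrow> real^'p \<Rightarrow> real"
    and Fhat :: "nat \<Rightarrow> 'a \<Rightarrow> 'p \<Rightarrow> real \<Rightarrow> real"
    and r :: "nat \<Rightarrow> real"
    and N :: "'b measure"
    and \<alpha> :: "'b \<Rightarrow> real^'p \<Rightarrow> real"
    and \<beta> :: "'b \<Rightarrow> 'p \<Rightarrow> real \<Rightarrow> real"
  assumes H_cdf: "mv_cdf H"
    and F_margin: "\<And>j. F j = margin H j"
    and F_cont: "\<And>j. continuous_on UNIV (F j)"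
    and C_deriv: "\<And>j u. u \<in> unit_cube \<Longrightarrow> 0 < u$j \<Longrightarrow> u$j < 1 \<Longrightarrow>
        ((\<lambda>t. copula_of H F (\<chi> i. if i = j then t else u$i)) has_real_derivative D j u) (at (u$j))"
    and D_cont: "\<And>j. continuous_on {u \<in> unit_cube. 0 < u$j \<and> u$j < 1} (D j)"
    and M_prob: "\<And>n. prob_space (M n)"
    and Hhat_cdf: "\<And>n \<omega>. \<omega> \<in> space (M n) \<Longrightarrow> mv_cdf (Hhat n \<omega>)"
    and Fhat_cdf: "\<And>n \<omega> j. \<omega> \<in> space (M n) \<Longrightarrow> uni_cdf (Fhat n \<omega> j)"
    and r_pos: "\<And>n. 0 < r n"
    and r_lim: "filterlim r at_top sequentially"
    and N_prob: "prob_space N"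
    and \<alpha>_elem: "\<forall>\<omega>\<in>space N. \<alpha> \<omega> \<in> linf unit_cube"
    and \<alpha>_meas: "linf_measurable N unit_cube \<alpha>"
    and \<beta>_elem: "\<And>j. \<forall>\<omega>\<in>space N. \<beta> \<omega> j \<in> linf {0..1}"
    and \<beta>_meas: "\<And>j. linf_measurable N {0..1} (\<lambda>\<omega>. \<beta> \<omega> j)"
    and \<alpha>F_cont: "AE \<omega> in N. continuous_on UNIV
                      (\<lambda>x::ereal^'p. \<alpha> \<omega> (\<chi> j. uni_ext (F j) (x$j)))"
    and \<beta>F_cont: "AE \<omega> in N. \<forall>j. continuous_on UNIV (\<lambda>t::ereal. \<beta> \<omega> j (uni_ext (F j) t))"
    and joint_conv: "hj_weak_conv M
        (\<lambda>n \<omega>. case_sum (\<lambda>x. r n * (Hhat n \<omega> x - H x))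
                          (\<lambda>(j, t). r n * (Fhat n \<omega> j t - F j t)))
        N UNIV
        (\<lambda>\<omega>. case_sum (\<lambda>x. \<alpha> \<omega> (\<chi> j. F j (x$j)))
                        (\<lambda>(j, t). \<beta> \<omega> j (F j t)))"
  shows "(\<forall>e>0. (\<lambda>n. outer_prob (M n)
             {\<omega> \<in> space (M n). \<exists>u\<in>unit_cube.
                \<bar>r n * (copula_of (Hhat n \<omega>) (Fhat n \<omega>) u - copula_of H F u)
                 - (r n * (cdf_ext (Hhat n \<omega>) (\<chi> j. gen_inv (F j) (u$j)) - copula_of H F u)
                    - (\<Sum>j\<in>UNIV. D j u * (r n * (uni_ext (Fhat n \<omega> j) (gen_inv (F j) (u$j)) - u$j))
                                   * indicator {0<..<1} (u$j)))\<bar> > e})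
           \<longlonglongrightarrow> 0)
       \<and> hj_weak_conv M
           (\<lambda>n \<omega> u. r n * (copula_of (Hhat n \<omega>) (Fhat n \<omega>) u - copula_of H F u))
           N unit_cube
           (\<lambda>\<omega> u. \<alpha> \<omega> u - (\<Sum>j\<in>UNIV. D j u * \<beta> \<omega> j (u$j)))
       \<and> (AE \<omega> in N. continuous_on unit_cube (\<alpha> \<omega>) \<and>
            (\<forall>j. continuous_on {0..1} (\<beta> \<omega> j) \<and> \<beta> \<omega> j 0 = 0 \<and> \<beta> \<omega> j 1 = 0))"
proof -
  interpret smooth_copula H F D
    by unfold_locales (fact H_cdf F_margin F_cont C_deriv D_cont)+
  define X where "X n \<omega> = emp_process (r n) (Hhat n \<omega>) (Fhat n \<omega>)" for n \<omega>
  define Y where "Y \<omega> = limit_process (\<alpha> \<omega>) (\<beta> \<omega>)" for \<omega>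
  define X' where "X' n \<omega> u = r n * (copula_of (Hhat n \<omega>) (Fhat n \<omega>) u - C u)" for n \<omega> u
  define Z where "Z \<omega> u = \<alpha> \<omega> u - (\<Sum>j\<in>UNIV. D j u * \<beta> \<omega> j (u$j))" for \<omega> u
  have conv: "hj_weak_conv M X N UNIV Y"
    using joint_conv by (simp add: X_def[abs_def] Y_def[abs_def] emp_process_def limit_process_def)
  have X_linf: "X n \<omega> \<in> linf UNIV" if "\<omega> \<in> space (M n)" for n \<omega>
    using conv that unfolding hj_weak_conv_def by blast
  have cont: "AE \<omega> in N. continuous_on unit_cube (\<alpha> \<omega>) \<and> (\<forall>j. continuous_on {0..1} (\<beta> \<omega> j))"
    using \<alpha>F_cont \<beta>F_cont
    by eventually_elim (blast intro: continuous_on_unit_cube_of_ereal continuous_on_unit_interval_of_ereal)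

  \<comment> \<open>All estimation processes have vanishing marginal tails, so \<open>A\<close>
    contains every prelimit trajectory and the limit must stay arbitrarily close to it.\<close>
  define A :: "((real^'p) + ('p \<times> real) \<Rightarrow> real) set"
    where "A = {g \<in> linf UNIV. \<forall>j. ((\<lambda>t. g (Inr (j, t))) \<longlongrightarrow> 0) at_bot \<and> ((\<lambda>t. g (Inr (j, t))) \<longlongrightarrow> 0) at_top}"
  \<comment> \<open>Countably many radii, so that the exceptional null sets can be united.\<close>
  have "AE \<omega> in N. \<exists>g\<in>A. linf_dist UNIV (Y \<omega>) g < 1 / (real k + 1)" for k
    by (rule hj_weak_conv_limit_near[OF N_prob M_prob conv])
      (auto simp: A_def X_linf, auto simp: X_def intro: emp_process_tails Fhat_cdf)
  then have "AE \<omega> in N. \<forall>k. \<exists>g\<in>A. linf_dist UNIV (Y \<omega>) g < 1 / (real k + 1)"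
    by (simp add: AE_all_countable)
  with cont have regular: "AE \<omega> in N. continuous_on unit_cube (\<alpha> \<omega>) \<and>
      (\<forall>j. continuous_on {0..1} (\<beta> \<omega> j) \<and> \<beta> \<omega> j 0 = 0 \<and> \<beta> \<omega> j 1 = 0)"
  proof eventually_elim
    case (elim \<omega>)
    have near: "\<exists>g\<in>linf UNIV. ((\<lambda>t. g (Inr (j, t))) \<longlongrightarrow> 0) at_bot \<and>
        ((\<lambda>t. g (Inr (j, t))) \<longlongrightarrow> 0) at_top \<and> linf_dist UNIV (limit_process (\<alpha> \<omega>) (\<beta> \<omega>)) g < e"
      if e: "0 < e" for e j
    proof -
      obtain k where k: "1 / (real k + 1) < e"
        using reals_Archimedean[OF e] by (auto simp: inverse_eq_divide add.commute)
      obtain g where "g \<in> A" "linf_dist UNIV (Y \<omega>) g < 1 / (real k + 1)" using elim(2) by blast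
      then show ?thesis using k unfolding A_def Y_def by (intro bexI[of _ g]) auto
    qed
    have "\<beta> \<omega> j 0 = 0 \<and> \<beta> \<omega> j 1 = 0" for j
      using limit_vanishes_at_endpoints[of "\<alpha> \<omega>" "\<beta> \<omega>" j] elim(1) near by blast
    then show ?case using elim(1) by blast
  qed

  \<comment> \<open>One event serves both conclusions: the first alternative is the remainder of the
    expansion, the second is what the approximation theorem for weak convergence requires.\<close>
  have close: "eventually (\<lambda>m. eventually (\<lambda>n. outer_prob (M n) {\<omega> \<in> space (M n). \<exists>u\<in>unit_cube.
      e < \<bar>X' n \<omega> u - linearization (r n) (Hhat n \<omega>) (Fhat n \<omega>) u\<bar> \<or>
      e < \<bar>X' n \<omega> u - lin_approx m (X n \<omega>) u\<bar>} < \<eta>) sequentially) sequentially"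
    if e: "0 < e" and \<eta>: "0 < \<eta>" for e \<eta>
  proof -
    \<comment> \<open>The expansion contributes \<open>1 + 8 * p\<close> and the clamping
      \<open>1 + p\<close>, in total \<open>2 + 9 * p\<close>, where \<open>p\<close> is the number
      of coordinates. The 3 comes from \<open>equicont_near\<close>.\<close>
    define \<epsilon> where "\<epsilon> = e / (3 * (2 + 9 * real CARD('p)))"
    have \<epsilon>: "0 < \<epsilon>" using e by (simp add: \<epsilon>_def)
    have "0 < 3 * (2 + 9 * real CARD('p))" by (simp add: add_pos_nonneg)
    then have "3 * (2 + 9 * real CARD('p)) \<noteq> 0" by (rule less_imp_neq[symmetric])
    then have "3 * (2 + 9 * real CARD('p)) * \<epsilon> = e" unfolding \<epsilon>_def by simp
    then have e_eq: "(1 + 8 * real CARD('p)) * (3 * \<epsilon>) + (1 + real CARD('p)) * (3 * \<epsilon>) = e"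
      by (simp add: algebra_simps)
    have e_ge: "(1 + 8 * real CARD('p)) * (3 * \<epsilon>) \<le> e"
    proof -
      have "0 \<le> (1 + real CARD('p)) * (3 * \<epsilon>)" using \<epsilon> by simp
      then show ?thesis using e_eq by linarith
    qed
    let ?A = "\<lambda>m. equicont F (real m) (1 / (real m + 1)) \<epsilon>"
    have "eventually (\<lambda>m. eventually (\<lambda>n. outer_prob (M n)
        {\<omega> \<in> space (M n). \<forall>g\<in>?A m. \<epsilon> \<le> linf_dist UNIV (X n \<omega>) g} < \<eta>) sequentially) sequentially"
    proof (rule hj_weak_conv_outer_prob_far[OF N_prob M_prob conv])
      show "?A m \<noteq> {}" for m using \<epsilon> by (auto simp: equicont_def intro!: exI[of _ "\<lambda>_. 0"])
      show "AE \<omega> in N. eventually (\<lambda>m. Y \<omega> \<in> ?A m) sequentially"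
        using cont by eventually_elim (auto simp: Y_def intro: limit_process_equicont \<epsilon>)
    qed (use \<epsilon> \<eta> in \<open>auto intro: subsetD[OF equicont_subset_linf]\<close>)
    then show ?thesis
    proof eventually_elim
      case (elim m)
      have "eventually (\<lambda>s. \<forall>H' G. mv_cdf H' \<longrightarrow> (\<forall>j. uni_cdf (G j)) \<longrightarrow>
        emp_process s H' G \<in> equicont F (real m + \<epsilon>) (1 / (real m + 1)) (3 * \<epsilon>) \<longrightarrow>
        (\<forall>u\<in>unit_cube. \<bar>s * (copula_of H' G u - C u) - linearization s H' G u\<bar>
          \<le> (1 + 8 * real CARD('p)) * (3 * \<epsilon>))) at_top"
        using \<epsilon> by (intro hybrid_copula_expansion) auto
      \<comment> \<open>With \<open>m\<close> fixed the threshold for the rate is fixed too, and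
        \<open>r n\<close> exceeds it eventually.\<close>
      from eventually_compose_filterlim[OF this r_lim] elim show ?case
      proof eventually_elim
        case (elim n)
        interpret Mn: prob_space "M n" by (rule M_prob)
        have "{\<omega> \<in> space (M n). \<exists>u\<in>unit_cube.
            e < \<bar>X' n \<omega> u - linearization (r n) (Hhat n \<omega>) (Fhat n \<omega>) u\<bar> \<or>
            e < \<bar>X' n \<omega> u - lin_approx m (X n \<omega>) u\<bar>} \<inter> space (M n)
          \<subseteq> {\<omega> \<in> space (M n). \<forall>g\<in>?A m. \<epsilon> \<le> linf_dist UNIV (X n \<omega>) g}"
        proof (clarify, rule ccontr)
          fix \<omega> u g assume w: "\<omega> \<in> space (M n)" and u: "u \<in> unit_cube" and g: "g \<in> ?A m"
            and far: "\<not> \<epsilon> \<le> linf_dist UNIV (X n \<omega>) g"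
            and bad: "e < \<bar>X' n \<omega> u - linearization (r n) (Hhat n \<omega>) (Fhat n \<omega>) u\<bar> \<or>
              e < \<bar>X' n \<omega> u - lin_approx m (X n \<omega>) u\<bar>"
          have "\<bar>X n \<omega> i - g i\<bar> \<le> \<epsilon>" for i
            using abs_diff_le_linf_dist[OF X_linf[OF w], of g i] equicont_subset_linf g far by force
          then have eq: "emp_process (r n) (Hhat n \<omega>) (Fhat n \<omega>) \<in> equicont F (real m + \<epsilon>) (1 / (real m + 1)) (3 * \<epsilon>)"
            using equicont_near[OF g] by (simp add: X_def)
          have 1: "\<bar>X' n \<omega> u - linearization (r n) (Hhat n \<omega>) (Fhat n \<omega>) u\<bar> \<le> (1 + 8 * real CARD('p)) * (3 * \<epsilon>)"
            unfolding X'_def using elim(1) Hhat_cdf[OF w] Fhat_cdf[OF w] eq u by blast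
          have 2: "\<bar>linearization (r n) (Hhat n \<omega>) (Fhat n \<omega>) u - lin_approx m (X n \<omega>) u\<bar> \<le> (1 + real CARD('p)) * (3 * \<epsilon>)"
            unfolding X_def by (rule linearization_near_lin_approx[OF Hhat_cdf[OF w] Fhat_cdf[OF w] eq u])
          show False using bad 1 2 e_eq e_ge by linarith
        qed
        from Mn.outer_prob_mono[OF this] elim(2) show ?case by linarith
      qed
    qed
  qed

  have remainder: "(\<lambda>n. outer_prob (M n) {\<omega> \<in> space (M n). \<exists>u\<in>unit_cube.
      \<bar>X' n \<omega> u - linearization (r n) (Hhat n \<omega>) (Fhat n \<omega>) u\<bar> > e}) \<longlonglongrightarrow> 0" if e: "0 < e" for e
  proof (rule order_tendstoI)
    fix c :: real assume "c < 0"
    then show "eventually (\<lambda>n. c < outer_prob (M n) {\<omega> \<in> space (M n). \<exists>u\<in>unit_cube.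
      \<bar>X' n \<omega> u - linearization (r n) (Hhat n \<omega>) (Fhat n \<omega>) u\<bar> > e}) sequentially"
      using prob_space.outer_prob_nonneg[OF M_prob] by (auto intro!: always_eventually elim: less_le_trans)
  next
    fix \<eta> :: real assume \<eta>: "0 < \<eta>"
    \<comment> \<open>The remainder itself does not involve \<open>m\<close>, so any one admissible
      \<open>m\<close> gives the bound.\<close>
    obtain m where "eventually (\<lambda>n. outer_prob (M n) {\<omega> \<in> space (M n). \<exists>u\<in>unit_cube.
      e < \<bar>X' n \<omega> u - linearization (r n) (Hhat n \<omega>) (Fhat n \<omega>) u\<bar> \<or>
      e < \<bar>X' n \<omega> u - lin_approx m (X n \<omega>) u\<bar>} < \<eta>) sequentially"
      using eventually_happens'[OF sequentially_bot close[OF e \<eta>]] by blast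
    then show "eventually (\<lambda>n. outer_prob (M n) {\<omega> \<in> space (M n). \<exists>u\<in>unit_cube.
      \<bar>X' n \<omega> u - linearization (r n) (Hhat n \<omega>) (Fhat n \<omega>) u\<bar> > e} < \<eta>) sequentially"
      by eventually_elim (rule le_less_trans[OF prob_space.outer_prob_mono[OF M_prob]], auto)
  qed

  have "hj_weak_conv M X' N unit_cube Z"
  proof (rule hj_weak_conv_approx[OF N_prob M_prob conv UNIV_not_empty unit_cube_nonempty, where T = lin_approx])
    show X'_linf: "X' n \<omega> \<in> linf unit_cube" if w: "\<omega> \<in> space (M n)" for n \<omega>
    proof (rule linfI)
      fix u :: "real^'p"
      have "\<bar>copula_of (Hhat n \<omega>) (Fhat n \<omega>) u - C u\<bar> \<le> 1"
        using cdf_ext_bounds[OF Hhat_cdf[OF w]] cdf_ext_bounds[OF H_cdf]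
        unfolding copula_of_def by (smt (verit))
      then show "\<bar>X' n \<omega> u\<bar> \<le> r n * 1"
        using r_pos[of n] by (simp add: X'_def abs_mult)
    qed
    \<comment> \<open>Quantifying over the countable scale \<open>1 / (real k + 1)\<close> inside
      the almost sure statement yields uniform convergence off a single null set.\<close>
    have approx: "AE \<omega> in N. \<forall>k. eventually (\<lambda>m. \<forall>u\<in>unit_cube. \<bar>lin_approx m (Y \<omega>) u - Z \<omega> u\<bar> \<le> 1 / (real k + 1)) sequentially"
      using regular
      by eventually_elim (auto simp: Y_def Z_def intro!: lin_approx_limit_process)
    have Y_linf: "AE \<omega> in N. Y \<omega> \<in> linf UNIV" using conv unfolding hj_weak_conv_def by blast
    with approx show "AE \<omega> in N. Z \<omega> \<in> linf unit_cube"
    proof eventually_elim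
      case (elim \<omega>)
      \<comment> \<open>The scale \<open>k = 0\<close> gives distance at most 1 from a bounded
        function, which bounds \<open>Z\<close>.\<close>
      obtain m where m: "\<forall>u\<in>unit_cube. \<bar>lin_approx m (Y \<omega>) u - Z \<omega> u\<bar> \<le> 1"
        using eventually_happens'[OF sequentially_bot spec[OF elim(1), of 0]] by auto
      obtain B where B: "\<forall>u\<in>unit_cube. \<bar>lin_approx m (Y \<omega>) u\<bar> \<le> B"
        using linf_bounded[OF lin_approx_linf[OF elim(2)]] by blast
      have "\<bar>Z \<omega> u\<bar> \<le> B + 1" if "u \<in> unit_cube" for u using m B that by fastforce
      then show ?case by (rule linfI)
    qed
    show "AE \<omega> in N. (\<lambda>m. linf_dist unit_cube (lin_approx m (Y \<omega>)) (Z \<omega>)) \<longlonglongrightarrow> 0"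
      using approx Y_linf \<open>AE \<omega> in N. Z \<omega> \<in> linf unit_cube\<close>
    proof eventually_elim
      case (elim \<omega>)
      show ?case
      proof (rule LIMSEQ_I)
        fix e :: real assume "0 < e"
        then obtain k where k: "1 / (real k + 1) < e"
          using reals_Archimedean[of e] by (auto simp: inverse_eq_divide add.commute)
        have "eventually (\<lambda>m. norm (linf_dist unit_cube (lin_approx m (Y \<omega>)) (Z \<omega>) - 0) < e) sequentially"
          using spec[OF elim(1), of k]
        proof eventually_elim
          case (elim m)
          have "linf_dist unit_cube (lin_approx m (Y \<omega>)) (Z \<omega>) \<le> 1 / (real k + 1)"
            using elim by (intro linf_dist_le unit_cube_nonempty) auto
          moreover have "0 \<le> linf_dist unit_cube (lin_approx m (Y \<omega>)) (Z \<omega>)"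
            by (intro linf_dist_nonneg unit_cube_nonempty lin_approx_linf \<open>Y \<omega> \<in> linf UNIV\<close> \<open>Z \<omega> \<in> linf unit_cube\<close>)
          ultimately show ?case using k by simp
        qed
        then show "\<exists>no. \<forall>m\<ge>no. norm (linf_dist unit_cube (lin_approx m (Y \<omega>)) (Z \<omega>) - 0) < e"
          by (simp add: eventually_sequentially)
      qed
    qed
    fix e \<eta> :: real assume "0 < e" "0 < \<eta>"
    from close[OF this] show "eventually (\<lambda>m. eventually (\<lambda>n. outer_prob (M n)
        {\<omega> \<in> space (M n). e < linf_dist unit_cube (X' n \<omega>) (lin_approx m (X n \<omega>))} < \<eta>) sequentially) sequentially"
    proof eventually_elim
      case (elim m)
      then show ?case
      proof eventually_elim
        case (elim n)
        \<comment> \<open>A supremum exceeding \<open>e\<close> must be exceeded at some point; this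
          is the contrapositive of \<open>linf_dist_le\<close>.\<close>
        have "{\<omega> \<in> space (M n). e < linf_dist unit_cube (X' n \<omega>) (lin_approx m (X n \<omega>))} \<inter> space (M n)
          \<subseteq> {\<omega> \<in> space (M n). \<exists>u\<in>unit_cube.
            e < \<bar>X' n \<omega> u - linearization (r n) (Hhat n \<omega>) (Fhat n \<omega>) u\<bar> \<or> e < \<bar>X' n \<omega> u - lin_approx m (X n \<omega>) u\<bar>}"
          using linf_dist_le[OF unit_cube_nonempty] by (auto simp: not_le[symmetric]) blast
        from prob_space.outer_prob_mono[OF M_prob this] elim show ?case by linarith
      qed
    qed
  qed (auto intro: lin_approx_linf lin_approx_lipschitz)
  then show ?thesis
    using remainder regular unfolding X'_def[abs_def] Z_def[abs_def] linearization_def by blast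
qed

end
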